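(* Let $1\le l\le k$ be integers and let $(x_1,x_2)\in\Delta(S_1)\times\Delta(S_2)$ be any Nash equilibrium of the $l$ vs $k$ game. Then, with probability 1 over $(s_1,s_2)\sim(x_1,x_2)$, all facilities are located in $o^k$, i.e. $s_1\cup s_2\subseteq o^k$.
   Context: Customers are uniformly distributed on $[0,1]$. For integers $1\le l\le k$, the $l$ vs $k$ game is the following two-player game. Set $n_1=l$, $n_2=k$. The pure strategy set of player $i\in\{1,2\}$ is $S_i=\{(s_i^1,\dots,s_i^{n_i})\in[0,1]^{n_i}: s_i^1<\dots<s_i^{n_i}\}$; a pure strategy is identified with the set of its $n_i$ coordinates (facility locations). For a pure profile $\mathbf s=(s_1,s_2)$ and a customer $t\in[0,1]$, let $r_t(\mathbf s)=\{i\in\{1,2\}: \min_{f\in s_i}|t-f|\le \min_{f\in s_1\cup s_2}|t-f|\}$. The payoff is $u_i(\mathbf s)=\int_0^1 \frac{\mathbf 1[i\in r_t(\mathbf s)]}{|r_t(\mathbf s)|}\,dt$. $\Delta(S_i)$ is the set of Borel probability measures on $S_i$ (mixed strategies; a pure strategy is identified with its point mass), and $u_i(\mathbf x)=\mathbb E_{\mathbf s\sim\mathbf x}u_i(\mathbf s)$ for $\mathbf x=(x_1,x_2)\in\Delta(S_1)\times\Delta(S_2)$, with $s_1\sim x_1$, $s_2\sim x_2$ independent. A profile $(x_1,x_2)$ is a Nash equilibrium if no player can strictly increase her payoff by a unilateral change of mixed strategy. $k$-socially optimal locations: $o^k=\{o_1^k,\dots,o_k^k\}$ with $o_i^k=\frac{2i-1}{2k}$.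 *)

theory Defs
  imports "HOL-Probability.Probability"
begin

text \<open>
  A pure strategy with \<open>n\<close> facilities is an increasing \<open>n\<close>-tuple in $[0,1]$, represented as an
  extensional function on \<open>{1..n}\<close>, i.e. as a point of the product space \<open>\<Pi>\<^sub>M i\<in>{1..n}. borel\<close>.
  As the index set is finite, the \<open>\<sigma>\<close>-algebra of that product is the Borel \<open>\<sigma>\<close>-algebra of
  $n$-dimensional Euclidean space.
\<close>

definition strategies :: "nat \<Rightarrow> (nat \<Rightarrow> real) set" where
  "strategies n = {s \<in> {1..n} \<rightarrow>\<^sub>E {0..1}. strict_mono_on {1..n} s}"

definition strategy_space :: "nat \<Rightarrow> (nat \<Rightarrow> real) measure" where
  "strategy_space n = restrict_space (\<Pi>\<^sub>M i\<in>{1..n}. borel) (strategies n)"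

definition mixed_strategies :: "nat \<Rightarrow> (nat \<Rightarrow> real) measure set" where
  "mixed_strategies n = {x. prob_space x \<and> sets x = sets (strategy_space n)}"

definition facilities :: "nat \<Rightarrow> (nat \<Rightarrow> real) \<Rightarrow> real set" where
  "facilities n s = s ` {1..n}"

text \<open>
  The players are \<open>1\<close> and \<open>2\<close>; player \<open>1\<close> has \<open>l\<close> facilities and player \<open>2\<close> has \<open>k\<close>.
\<close>

definition player_facilities ::
  "nat \<Rightarrow> nat \<Rightarrow> (nat \<Rightarrow> real) \<times> (nat \<Rightarrow> real) \<Rightarrow> nat \<Rightarrow> real set" where
  "player_facilities l k s i =
     (if i = 1 then facilities l (fst s) else facilities k (snd s))"

definition nearest_players ::
  "nat \<Rightarrow> nat \<Rightarrow> (nat \<Rightarrow> real) \<times> (nat \<Rightarrow> real) \<Rightarrow> real \<Rightarrow> nat set" where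
  "nearest_players l k s t =
     {i \<in> {1, 2}. (MIN f\<in>player_facilities l k s i. \<bar>t - f\<bar>)
                  \<le> (MIN f\<in>player_facilities l k s 1 \<union> player_facilities l k s 2. \<bar>t - f\<bar>)}"

definition payoff ::
  "nat \<Rightarrow> nat \<Rightarrow> nat \<Rightarrow> (nat \<Rightarrow> real) \<times> (nat \<Rightarrow> real) \<Rightarrow> real" where
  "payoff l k i s =
     (LBINT t:{0..1}. of_bool (i \<in> nearest_players l k s t) / real (card (nearest_players l k s t)))"

definition expected_payoff ::
  "nat \<Rightarrow> nat \<Rightarrow> nat \<Rightarrow> (nat \<Rightarrow> real) measure \<Rightarrow> (nat \<Rightarrow> real) measure \<Rightarrow> real" where
  "expected_payoff l k i x1 x2 = (LINT s|(x1 \<Otimes>\<^sub>M x2). payoff l k i s)"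

definition nash_equilibrium ::
  "nat \<Rightarrow> nat \<Rightarrow> (nat \<Rightarrow> real) measure \<Rightarrow> (nat \<Rightarrow> real) measure \<Rightarrow> bool" where
  "nash_equilibrium l k x1 x2 \<longleftrightarrow>
     x1 \<in> mixed_strategies l \<and> x2 \<in> mixed_strategies k \<and>
     (\<forall>y1 \<in> mixed_strategies l. expected_payoff l k 1 y1 x2 \<le> expected_payoff l k 1 x1 x2) \<and>
     (\<forall>y2 \<in> mixed_strategies k. expected_payoff l k 2 x1 y2 \<le> expected_payoff l k 2 x1 x2)"

definition optimal_locations :: "nat \<Rightarrow> real set" where
  "optimal_locations k = (\<lambda>i. (2 * real i - 1) / (2 * real k)) ` {1..k}"

end

theory Submission
  imports Defs
begin

text \<open>
  The share of a set of facilities at a customer is the largest share of one of its members, so the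
  market captured by a set is at most the sum of what its members capture separately. Against $o^k$ a
  single facility captures at most $1/(2k)$, so player 2 can hold player 1 to $l/(2k)$; conversely, averaging
  over all $l$-subsets of $o^k$, player 1 secures $l/k$ times what $o^k$ captures against \<open>s\<^sub>2\<close>, which
  is at least $1/2$, with equality only for $s_2 = o^k$. So the value is $l/(2k)$ and \<open>x\<^sub>2\<close> sits at $o^k$.

  For player 1, every deviation of player 2 must leave her at least $l/(2k)$. First, $o^k$ itself forces her
  facilities into $[o_1, o_k]$. Then let player 2 move $o_i$ to the right by $\varepsilon (i(k-i) + \eta)$,
  or play the mirror image of this. With $\eta > 0$ every shift is nonzero, which breaks the ties at the
  $o_i$. In total over the two deviations, a facility at $o_i$ captures at most $\varepsilon\eta$ more than
  $1/k$, while for one strictly between $o_i$ and $o_{i+1}$ the excess is half of $\varepsilon$ times the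
  second difference $-2$ of $i(k-i)$, once $\varepsilon$ is small. Letting $\varepsilon, \eta \to 0$, the latter must have probability 0.
\<close>

section \<open>Market shares\<close>

definition nearest_dist :: "real set \<Rightarrow> real \<Rightarrow> real" where
  "nearest_dist A t = (MIN f\<in>A. \<bar>t - f\<bar>)"

text \<open>The arguments are sets of locations rather than strategies, so a single facility or all
  of o^k can be measured against an opponent whatever the sizes \<open>l\<close> and
  \<open>k\<close>.\<close>

definition market_share :: "real set \<Rightarrow> real set \<Rightarrow> real \<Rightarrow> real" where
  "market_share A B t =
     (if nearest_dist A t < nearest_dist B t then 1
      else if nearest_dist A t = nearest_dist B t then 1/2 else 0)"

definition captured :: "real set \<Rightarrow> real set \<Rightarrow> real" where
  "captured A B = (LBINT t:{0..1}. market_share A B t)"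

lemma nearest_dist_singleton [simp]: "nearest_dist {f} t = \<bar>t - f\<bar>"
  by (simp add: nearest_dist_def)

lemma nearest_dist_le: "finite A \<Longrightarrow> f \<in> A \<Longrightarrow> nearest_dist A t \<le> \<bar>t - f\<bar>"
  by (simp add: nearest_dist_def)

lemma le_nearest_dist_iff:
  "finite A \<Longrightarrow> A \<noteq> {} \<Longrightarrow> x \<le> nearest_dist A t \<longleftrightarrow> (\<forall>f\<in>A. x \<le> \<bar>t - f\<bar>)"
  by (simp add: nearest_dist_def)

lemma nearest_dist_attained:
  assumes "finite A" "A \<noteq> {}"
  obtains f where "f \<in> A" "nearest_dist A t = \<bar>t - f\<bar>"
proof -
  have "nearest_dist A t \<in> (\<lambda>f. \<bar>t - f\<bar>) ` A"
    unfolding nearest_dist_def using assms by (intro Min_in) auto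
  then show ?thesis using that by blast
qed

lemma borel_measurable_nearest_dist [measurable]:
  "finite A \<Longrightarrow> nearest_dist A \<in> borel_measurable borel"
  unfolding nearest_dist_def by measurable

lemma borel_measurable_market_share [measurable]:
  "finite A \<Longrightarrow> finite B \<Longrightarrow> market_share A B \<in> borel_measurable borel"
  unfolding market_share_def by measurable

lemma market_share_bounds: "0 \<le> market_share A B t" "market_share A B t \<le> 1"
  by (auto simp: market_share_def)

lemma market_share_complement: "market_share B A t = 1 - market_share A B t"
  by (auto simp: market_share_def)

lemma set_integrable_unit_interval:
  fixes h :: "real \<Rightarrow> real"
  assumes "h \<in> borel_measurable borel" "\<And>t. \<bar>h t\<bar> \<le> C"
  shows "set_integrable lborel {0..1} h"
proof (rule set_integrable_bound)
  show "set_integrable lborel {0..1::real} (\<lambda>_. C)" by (simp add: set_integrable_def)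
  show "set_borel_measurable lborel {0..1} h"
    using assms(1) by (simp add: set_borel_measurable_def)
  show "AE x in lborel. x \<in> {0..1} \<longrightarrow> norm (h x) \<le> norm C"
    using assms(2) by (auto intro!: AE_I2 simp: order_trans[OF _ abs_ge_self])
qed

lemma set_integrable_market_share [simp]:
  "finite A \<Longrightarrow> finite B \<Longrightarrow> set_integrable lborel {0..1} (market_share A B)"
  by (rule set_integrable_unit_interval[where C = 1])
    (auto simp: market_share_bounds abs_le_iff intro: order_trans[OF _ market_share_bounds(1)])

lemma LBINT_unit_interval_const: "(LBINT t:{0..1::real}. c) = (c::real)"
  by (simp add: set_lebesgue_integral_def content_real)

lemma set_integrable_unit_interval_const [simp]: "set_integrable lborel {0..1::real} (\<lambda>_. c::real)"
  by (simp add: set_integrable_def)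

lemma captured_complement:
  assumes "finite A" "finite B"
  shows "captured B A = 1 - captured A B"
proof -
  have "captured B A = (LBINT t:{0..1}. 1 - market_share A B t)"
    unfolding captured_def by (subst market_share_complement) simp
  also have "\<dots> = 1 - captured A B"
    unfolding captured_def using assms
    by (subst set_integral_diff(2)) (auto simp: LBINT_unit_interval_const)
  finally show ?thesis .
qed

lemma captured_bounds:
  assumes "finite A" "finite B"
  shows "0 \<le> captured A B" "captured A B \<le> 1"
proof -
  have *: "0 \<le> captured A B" if "finite A" "finite B" for A B
    unfolding captured_def set_lebesgue_integral_def
    by (rule integral_nonneg_AE) (auto simp: market_share_bounds)
  show "0 \<le> captured A B" using * assms .
  show "captured A B \<le> 1" using *[OF assms(2,1)] captured_complement[OF assms] by simp
qed

lemma integral_indicator_interval_le: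
  fixes p q :: real
  assumes "p \<le> q"
  shows "(LBINT t:{0..1}. indicator {p..q} t) \<le> q - p"
proof -
  have "(LBINT t:{0..1}. indicator {p..q} t :: real) = measure lborel ({0..1} \<inter> {p..q})"
    unfolding set_lebesgue_integral_def
    by (simp flip: indicator_inter_arith add: mult.commute)
  also have "\<dots> \<le> measure lborel {p..q}"
    using assms by (intro measure_mono_fmeasurable) (auto simp: fmeasurable_def)
  also have "\<dots> = q - p" using assms by simp
  finally show ?thesis .
qed

text \<open>The factor \<open>c\<close> will be 1 for a facility on a vacant spot and 1/2 for one
  that shares its spot with a rival. The interval may stick out of [0,1], so only an upper bound
  results.\<close>

lemma captured_le_interval:
  assumes "finite A" "finite B" "p \<le> q" "0 \<le> c"
    and "\<And>t. 0 \<le> t \<Longrightarrow> t \<le> 1 \<Longrightarrow> market_share A B t \<le> (if p \<le> t \<and> t \<le> q then c else 0)"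
  shows "captured A B \<le> c * (q - p)"
proof -
  have "captured A B \<le> (LBINT t:{0..1}. c * indicator {p..q} t)"
    unfolding captured_def
  proof (rule set_integral_mono)
    show "set_integrable lborel {0..1} (\<lambda>t. c * indicator {p..q} t)"
      using \<open>0 \<le> c\<close> by (intro set_integrable_unit_interval[where C = c]) (auto simp: indicator_def)
    show "market_share A B t \<le> c * indicator {p..q} t" if "t \<in> {0..1}" for t
      using assms(5)[of t] that by (auto simp: indicator_def split: if_splits)
  qed (use assms in simp)
  also have "\<dots> \<le> c * (q - p)"
    using integral_indicator_interval_le[OF \<open>p \<le> q\<close>] \<open>0 \<le> c\<close> by (simp add: mult_left_mono)
  finally show ?thesis .
qed

section \<open>Catchment interval of a single facility\<close>

text \<open>A facility at \<open>f\<close> wins no customer to the left of \<open>p\<close>: either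
  there is none, or a rival \<open>a\<close> left of \<open>f\<close> is strictly nearer to all of
  them. Any \<open>p\<close> up to the midpoint is allowed, so that convenient bounds can be plugged
  in; \<open>upper_cutoff\<close> is the same on the right.\<close>

definition lower_cutoff :: "real set \<Rightarrow> real \<Rightarrow> real \<Rightarrow> bool" where
  "lower_cutoff B f p \<longleftrightarrow> p \<le> 0 \<or> (\<exists>a\<in>B. a < f \<and> p \<le> (a + f) / 2)"

definition upper_cutoff :: "real set \<Rightarrow> real \<Rightarrow> real \<Rightarrow> bool" where
  "upper_cutoff B f q \<longleftrightarrow> 1 \<le> q \<or> (\<exists>b\<in>B. f < b \<and> (f + b) / 2 \<le> q)"

lemma lower_cutoff_0: "p \<le> 0 \<Longrightarrow> lower_cutoff B f p"
  by (simp add: lower_cutoff_def)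

lemma lower_cutoffI: "a \<in> B \<Longrightarrow> a < f \<Longrightarrow> p \<le> (a + f) / 2 \<Longrightarrow> lower_cutoff B f p"
  by (auto simp: lower_cutoff_def)

lemma upper_cutoffI: "b \<in> B \<Longrightarrow> f < b \<Longrightarrow> (f + b) / 2 \<le> q \<Longrightarrow> upper_cutoff B f q"
  by (auto simp: upper_cutoff_def)

lemma market_share_singleton_outside_cutoffs:
  assumes "finite B" "lower_cutoff B f p" "upper_cutoff B f q" "0 \<le> t" "t \<le> 1" "\<not> (p \<le> t \<and> t \<le> q)"
  shows "market_share {f} B t = 0"
proof -
  have "\<exists>b\<in>B. \<bar>t - b\<bar> < \<bar>t - f\<bar>"
  proof (cases "p \<le> t")
    case True
    then have "q < t" using assms by auto
    then obtain b where "b \<in> B" "f < b" "(f + b) / 2 < t"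
      using assms(3,5) by (force simp: upper_cutoff_def)
    then show ?thesis by (intro bexI[of _ b]) (auto simp: abs_if field_simps)
  next
    case False
    then obtain a where "a \<in> B" "a < f" "t < (a + f) / 2"
      using assms(2,4) by (force simp: lower_cutoff_def)
    then show ?thesis by (intro bexI[of _ a]) (auto simp: abs_if field_simps)
  qed
  then obtain b where "b \<in> B" "\<bar>t - b\<bar> < \<bar>t - f\<bar>" by blast
  then show ?thesis
    using nearest_dist_le[OF assms(1), of b t] by (simp add: market_share_def)
qed

lemma captured_singleton_le:
  assumes "finite B" "lower_cutoff B f p" "upper_cutoff B f q" "p \<le> q"
  shows "captured {f} B \<le> q - p"
  using captured_le_interval[of "{f}" B p q 1] assms market_share_singleton_outside_cutoffs[OF assms(1-3)]
  by (auto simp: market_share_bounds)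

text \<open>The rival on the same spot is never farther from a customer than \<open>f\<close> is, so
  \<open>f\<close> gets at most the tie share 1/2 anywhere.\<close>

lemma captured_occupied_le:
  assumes "finite B" "f \<in> B" "lower_cutoff B f p" "upper_cutoff B f q" "p \<le> q"
  shows "captured {f} B \<le> (q - p) / 2"
proof -
  have "market_share {f} B t \<le> 1/2" for t
    using nearest_dist_le[OF assms(1,2), of t] by (simp add: market_share_def)
  then show ?thesis
    using captured_le_interval[of "{f}" B p q "1/2"] assms
      market_share_singleton_outside_cutoffs[OF assms(1,3,4)]
    by auto
qed

section \<open>Subadditivity of the captured market\<close>

lemma market_share_member:
  assumes "finite A" "f \<in> A"
  shows "market_share {f} B t \<le> market_share A B t"
  using nearest_dist_le[OF assms, of t] by (auto simp: market_share_def)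

lemma market_share_attained:
  assumes "finite A" "A \<noteq> {}"
  obtains f where "f \<in> A" "market_share A B t = market_share {f} B t"
  by (rule nearest_dist_attained[OF assms, of t]) (auto simp: market_share_def intro: that)

lemma market_share_le_sum:
  assumes "finite A" "A \<noteq> {}"
  shows "market_share A B t \<le> (\<Sum>f\<in>A. market_share {f} B t)"
proof -
  obtain f where "f \<in> A" "market_share A B t = market_share {f} B t"
    by (rule market_share_attained[OF assms])
  then show ?thesis
    using assms member_le_sum[of f A "\<lambda>f. market_share {f} B t"] by (simp add: market_share_bounds)
qed

lemma LBINT_sum_market_share:
  assumes "finite A" "finite B"
  shows "(LBINT t:{0..1}. \<Sum>f\<in>A. market_share {f} B t) = (\<Sum>f\<in>A. captured {f} B)"
    and "set_integrable lborel {0..1} (\<lambda>t. \<Sum>f\<in>A. market_share {f} B t)"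
proof -
  have *: "integrable lborel (\<lambda>t. indicator {0..1} t *\<^sub>R market_share {f} B t)" for f
    using set_integrable_market_share[of "{f}" B] assms by (simp add: set_integrable_def)
  show "(LBINT t:{0..1}. \<Sum>f\<in>A. market_share {f} B t) = (\<Sum>f\<in>A. captured {f} B)"
    unfolding captured_def set_lebesgue_integral_def scaleR_sum_right
    by (rule Bochner_Integration.integral_sum) (rule *)
  show "set_integrable lborel {0..1} (\<lambda>t. \<Sum>f\<in>A. market_share {f} B t)"
    unfolding set_integrable_def scaleR_sum_right by (intro Bochner_Integration.integrable_sum *)
qed

lemma captured_le_sum:
  assumes "finite A" "A \<noteq> {}" "finite B"
  shows "captured A B \<le> (\<Sum>f\<in>A. captured {f} B)"
proof -
  have "captured A B \<le> (LBINT t:{0..1}. \<Sum>f\<in>A. market_share {f} B t)"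
    unfolding captured_def
    using assms by (intro set_integral_mono market_share_le_sum LBINT_sum_market_share) auto
  then show ?thesis using assms by (simp add: LBINT_sum_market_share)
qed

text \<open>A strict form of \<open>captured_le_sum\<close>: a customer of whom two members each get
  at least 1/2 is overcounted by at least 1/2 in the sum, and such customers fill an interval of
  positive length.\<close>

lemma captured_le_sum_overlap:
  assumes "finite A" "finite B" "f \<in> A" "g \<in> A" "f \<noteq> g" "0 \<le> p" "p < q" "q \<le> 1"
    and "\<And>t. p \<le> t \<Longrightarrow> t \<le> q \<Longrightarrow> market_share {f} B t \<ge> 1/2 \<and> market_share {g} B t \<ge> 1/2"
  shows "captured A B < (\<Sum>f\<in>A. captured {f} B)"
proof -
  have pw: "market_share A B t + 1/2 * indicator {p..q} t \<le> (\<Sum>f\<in>A. market_share {f} B t)" for t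
  proof (cases "t \<in> {p..q}")
    case True
    obtain h where h: "h \<in> A" "market_share A B t = market_share {h} B t"
      using market_share_attained[of A B t] assms(1,3) by blast
    \<comment> \<open>At least one of \<open>f\<close> and \<open>g\<close> differs from the member
      \<open>h\<close> that already accounts for the share of \<open>A\<close>.\<close>
    obtain h' where h': "h' \<in> A" "h' \<noteq> h" "market_share {h'} B t \<ge> 1/2"
      using assms(3,4,5) assms(9)[of t] True by (cases "h = f") auto
    have "market_share A B t + 1/2 \<le> (\<Sum>x\<in>{h,h'}. market_share {x} B t)"
      using h h' by simp
    also have "\<dots> \<le> (\<Sum>f\<in>A. market_share {f} B t)"
      using h h' assms(1) by (intro sum_mono2) (auto simp: market_share_bounds)
    finally show ?thesis using True by simp
  next
    case False
    then show ?thesis using market_share_le_sum[of A B t] assms(1,3) by auto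
  qed
  have ind: "set_integrable lborel {0..1} (\<lambda>t. 1/2 * indicator {p..q} t :: real)"
    by (intro set_integrable_unit_interval[where C = 1]) (auto simp: indicator_def)
  have "(LBINT t:{0..1}. 1/2 * indicator {p..q} t) = 1/2 * measure lborel ({0..1} \<inter> {p..q})"
    unfolding set_lebesgue_integral_def
    by (simp flip: indicator_inter_arith add: mult.commute)
  also have "{0..1} \<inter> {p..q} = {p..q}" using assms by auto
  finally have "captured A B + (q - p) / 2
      = (LBINT t:{0..1}. market_share A B t + 1/2 * indicator {p..q} t)"
    unfolding captured_def using assms(1,2,7) ind by (subst set_integral_add(2)) auto
  also have "\<dots> \<le> (LBINT t:{0..1}. \<Sum>f\<in>A. market_share {f} B t)"
    using assms(1,2) ind pw
    by (intro set_integral_mono LBINT_sum_market_share set_integral_add) auto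
  also have "\<dots> = (\<Sum>f\<in>A. captured {f} B)" using assms by (simp add: LBINT_sum_market_share)
  finally have "captured A B + (q - p) / 2 \<le> (\<Sum>f\<in>A. captured {f} B)" .
  moreover have "0 < (q - p) / 2" using assms(7) by simp
  ultimately show ?thesis by argo
qed

section \<open>Reflection of the unit interval\<close>

lemma nearest_dist_reflect: "nearest_dist ((\<lambda>x. 1 - x) ` A) (1 - t) = nearest_dist A t"
proof -
  have "(\<lambda>x. \<bar>1 - t - x\<bar>) ` (\<lambda>x. 1 - x) ` A = (\<lambda>x. \<bar>t - x\<bar>) ` A"
    unfolding image_image by (rule image_cong) auto
  then show ?thesis by (simp add: nearest_dist_def)
qed

lemma captured_reflect:
  "captured ((\<lambda>x. 1 - x) ` A) ((\<lambda>x. 1 - x) ` B) = captured A B"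
proof -
  have "captured ((\<lambda>x. 1 - x) ` A) ((\<lambda>x. 1 - x) ` B)
    = (\<integral>t. indicator {0..1} (1 + (-1) * t) *
        market_share ((\<lambda>x. 1 - x) ` A) ((\<lambda>x. 1 - x) ` B) (1 + (-1) * t) \<partial>lborel)"
    unfolding captured_def set_lebesgue_integral_def
    by (subst lborel_integral_real_affine[where c = "-1" and t = 1]) auto
  also have "\<dots> = captured A B"
    unfolding captured_def set_lebesgue_integral_def
    by (rule Bochner_Integration.integral_cong)
      (auto simp: market_share_def nearest_dist_reflect indicator_def)
  finally show ?thesis .
qed

section \<open>Facilities against the optimal locations\<close>

text \<open>For \<open>k\<close> at least 1 the indices 0 and \<open>Suc k\<close> continue the grid
  with spacing 1/k just outside [0,1], so that statements about the neighbour \<open>Suc i\<close>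
  also make sense at the last index.\<close>

definition optimal_location :: "nat \<Rightarrow> nat \<Rightarrow> real" where
  "optimal_location k i = (2 * real i - 1) / (2 * real k)"

lemma optimal_locations_eq: "optimal_locations k = optimal_location k ` {1..k}"
  by (simp add: optimal_locations_def optimal_location_def)

lemma finite_optimal_locations [simp]: "finite (optimal_locations k)"
  by (simp add: optimal_locations_def)

lemma optimal_location_Suc:
  "1 \<le> k \<Longrightarrow> optimal_location k (Suc i) = optimal_location k i + 1 / real k"
  by (simp add: optimal_location_def field_simps)

lemma optimal_location_first: "optimal_location k (Suc 0) = 1 / (2 * real k)"
  by (simp add: optimal_location_def)

lemma optimal_location_last: "1 \<le> k \<Longrightarrow> optimal_location k k = 1 - 1 / (2 * real k)"
  by (simp add: optimal_location_def field_simps)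

lemma optimal_location_less_iff:
  "1 \<le> k \<Longrightarrow> optimal_location k i < optimal_location k j \<longleftrightarrow> i < j"
  by (simp add: optimal_location_def divide_less_cancel)

lemma optimal_location_le_iff:
  "1 \<le> k \<Longrightarrow> optimal_location k i \<le> optimal_location k j \<longleftrightarrow> i \<le> j"
  by (simp add: optimal_location_def divide_le_cancel)

lemma optimal_location_mem: "1 \<le> i \<Longrightarrow> i \<le> k \<Longrightarrow> optimal_location k i \<in> optimal_locations k"
  by (auto simp: optimal_locations_eq)

lemma optimal_locations_subset: "optimal_locations k \<subseteq> {0..1}"
proof
  fix x assume "x \<in> optimal_locations k"
  then obtain i where "1 \<le> i" "i \<le> k" "x = optimal_location k i"
    by (auto simp: optimal_locations_eq)
  then show "x \<in> {0..1}" by (simp add: optimal_location_def divide_le_eq_1)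
qed

lemma card_optimal_locations: "card (optimal_locations k) = k"
proof (cases "k = 0")
  case False
  then have "inj_on (optimal_location k) {1..k}"
    by (intro inj_onI) (simp add: optimal_location_def)
  then show ?thesis by (simp add: optimal_locations_eq card_image)
qed (simp add: optimal_locations_eq)

lemma optimal_location_reflect:
  "1 \<le> k \<Longrightarrow> i \<le> k \<Longrightarrow> 1 - optimal_location k i = optimal_location k (Suc k - i)"
  by (simp add: optimal_location_def field_simps of_nat_diff)

lemma optimal_location_cases:
  assumes "1 \<le> k" "optimal_location k 1 \<le> f" "f \<le> optimal_location k k"
  obtains (on) i where "1 \<le> i" "i \<le> k" "f = optimal_location k i"
    | (between) i where "1 \<le> i" "i < k" "optimal_location k i < f" "f < optimal_location k (Suc i)"
proof -
  \<comment> \<open>The largest index with o_i at most \<open>f\<close>, since o_i <= f is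
    equivalent to i <= k f + 1/2.\<close>
  define i where "i = nat \<lfloor>real k * f + 1/2\<rfloor>"
  have "1 \<le> real k * f + 1/2" using assms by (simp add: optimal_location_def field_simps)
  then have fl: "real i \<le> real k * f + 1/2" "real k * f + 1/2 < real i + 1" "1 \<le> i"
    unfolding i_def by (linarith+)
  then have *: "optimal_location k i \<le> f" "f < optimal_location k (Suc i)"
    using assms(1) by (simp_all add: optimal_location_def field_simps)
  then have "optimal_location k i \<le> optimal_location k k" using assms by linarith
  then have "i \<le> k" using assms(1) by (simp add: optimal_location_le_iff)
  show thesis
  proof (cases "optimal_location k i = f")
    case True
    then show ?thesis using on fl(3) \<open>i \<le> k\<close> by auto
  next
    case False
    then have "i \<noteq> k" using assms * by auto
    then show ?thesis using between[of i] False * fl(3) \<open>i \<le> k\<close> by auto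
  qed
qed

section \<open>Capture bounds against the optimal locations\<close>

text \<open>Strictly between two neighbours, the midpoints cut out half of the spacing 1/k. On some
  o_i the catchment has length 1/k but is shared with the rival. Outside [o_1, o_k] the facility
  only reaches from the end of [0,1] to a midpoint and so loses half of its distance to the extreme
  location.\<close>

lemma captured_optimal_le:
  assumes "1 \<le> k" "0 \<le> f" "f \<le> 1"
  shows "captured {f} (optimal_locations k)
    \<le> 1 / (2 * real k) - max 0 (optimal_location k 1 - f) / 2 - max 0 (f - optimal_location k k) / 2"
    (is "?c \<le> _")
proof -
  let ?o = "optimal_location k"
  have o1k: "?o 1 \<le> ?o k" using assms by (simp add: optimal_location_le_iff)
  consider "f < ?o 1" | "f > ?o k" | "?o 1 \<le> f" "f \<le> ?o k" by linarith
  then show ?thesis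
  proof cases
    case 1
    have "?c \<le> (f + ?o 1) / 2 - 0"
      using 1 assms optimal_location_mem[of 1 k]
      by (intro captured_singleton_le) (auto simp: lower_cutoff_def upper_cutoff_def)
    then show ?thesis using 1 o1k by (simp add: optimal_location_first) argo
  next
    case 2
    have "?c \<le> 1 - (?o k + f) / 2"
      using 2 assms optimal_location_mem[of k k] 
      by (intro captured_singleton_le) (auto simp: lower_cutoff_def upper_cutoff_def)
    then show ?thesis using 2 o1k assms(1)
      by (simp add: optimal_location_last) argo
  next
    case 3
    have "?c \<le> 1 / (2 * real k)"
      using assms(1) 3
    proof (cases rule: optimal_location_cases)
      case (on i)
      \<comment> \<open>For i = 1 this point is the end 0 of the interval, otherwise the midpoint of
        o_(i-1) and o_i.\<close>
      have "lower_cutoff (optimal_locations k) f (f - 1 / (2 * real k))"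
      proof (cases "i = 1")
        case False
        then have "?o (i - 1) \<in> optimal_locations k" "?o i = ?o (i - 1) + 1 / k"
          using on assms optimal_location_Suc[of k "i - 1"] by (auto intro!: optimal_location_mem)
        then show ?thesis using on assms by (intro lower_cutoffI[of "?o (i - 1)"]) auto
      qed (use on in \<open>simp add: lower_cutoff_def optimal_location_first\<close>)
      moreover have "upper_cutoff (optimal_locations k) f (f + 1 / (2 * real k))"
      proof (cases "i = k")
        case False
        then have "?o (Suc i) \<in> optimal_locations k"
          using on by (intro optimal_location_mem) auto
        moreover have "?o (Suc i) = ?o i + 1 / k"
          using assms(1) by (rule optimal_location_Suc)
        ultimately show ?thesis using on assms by (intro upper_cutoffI[of "?o (Suc i)"]) auto
      qed (use on assms in \<open>simp add: upper_cutoff_def optimal_location_last\<close>)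
      ultimately have "?c \<le> ((f + 1 / (2 * real k)) - (f - 1 / (2 * real k))) / 2"
        using on by (intro captured_occupied_le) (auto intro: optimal_location_mem)
      then show ?thesis by simp
    next
      case (between i)
      have "?c \<le> (f + ?o (Suc i)) / 2 - (?o i + f) / 2"
        using between
        by (intro captured_singleton_le lower_cutoffI[of "?o i"] upper_cutoffI[of "?o (Suc i)"]
             optimal_location_mem) auto
      also have "\<dots> = 1 / (2 * real k)"
        using optimal_location_Suc[OF assms(1), of i] by (simp add: field_simps)
      finally show ?thesis .
    qed
    then show ?thesis using 3 by simp
  qed
qed

lemma captured_optimal_le_share:
  assumes "1 \<le> k" "0 \<le> f" "f \<le> 1"
  shows "captured {f} (optimal_locations k) \<le> 1 / (2 * real k)"
  using captured_optimal_le[OF assms] max.cobounded1[of 0 "optimal_location k 1 - f"]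
    max.cobounded1[of 0 "f - optimal_location k k"] by argo

lemma captured_optimal_le_card:
  assumes "1 \<le> k" "A \<subseteq> {0..1}" "finite A" "A \<noteq> {}"
  shows "captured A (optimal_locations k) \<le> real (card A) / (2 * real k)"
proof -
  have "captured A (optimal_locations k) \<le> (\<Sum>f\<in>A. captured {f} (optimal_locations k))"
    using assms by (simp add: captured_le_sum)
  also have "\<dots> \<le> (\<Sum>f\<in>A. 1 / (2 * real k))"
    using assms by (intro sum_mono captured_optimal_le_share) auto
  finally show ?thesis by simp
qed

text \<open>No optimal location lies strictly inside a gap, so \<open>f\<close> need only be
  compared with the two ends. It may itself be one of them and then merely ties, which is why the
  bound is 1/2.\<close>

lemma market_share_between_optimal:
  assumes "1 \<le> k" "1 \<le> i" "i < k" "optimal_location k i \<le> f" "f \<le> optimal_location k (Suc i)"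
    and "(optimal_location k i + f) / 2 \<le> t" "t \<le> (f + optimal_location k (Suc i)) / 2"
  shows "market_share {f} (optimal_locations k) t \<ge> 1/2"
proof -
  have "\<bar>t - f\<bar> \<le> \<bar>t - x\<bar>" if x: "x \<in> optimal_locations k" for x
  proof -
    obtain j where j: "x = optimal_location k j" using x by (auto simp: optimal_locations_eq)
    then have "x \<le> optimal_location k i \<or> optimal_location k (Suc i) \<le> x"
      using assms(1) by (auto simp: optimal_location_le_iff not_less_eq_eq)
    then show ?thesis using assms by argo
  qed
  then have "\<bar>t - f\<bar> \<le> nearest_dist (optimal_locations k) t"
    using assms(1) optimal_location_mem[of 1 k] by (subst le_nearest_dist_iff) auto
  then show ?thesis by (simp add: market_share_def)
qed

text \<open>If some optimal location is vacant, two of the \<open>k\<close> facilities share one of the \<open>k - 1\<close> gaps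
  without both sitting at its ends, so their separate catchment areas overlap.\<close>

lemma captured_optimal_less_half:
  assumes "1 \<le> k" "A \<subseteq> {0..1}" "finite A" "card A = k" "A \<noteq> optimal_locations k"
  shows "captured A (optimal_locations k) < 1/2"
proof (cases "A \<subseteq> {optimal_location k 1..optimal_location k k}")
  case False
  let ?O = "optimal_locations k"
  \<comment> \<open>A facility outside [o_1, o_k] captures strictly less than 1/(2k), which already
    makes the sum strict.\<close>
  obtain g where g: "g \<in> A" "\<not> (optimal_location k 1 \<le> g \<and> g \<le> optimal_location k k)"
    using False by (metis atLeastAtMost_iff subsetI)
  have "captured A ?O \<le> (\<Sum>f\<in>A. captured {f} ?O)"
    using assms by (intro captured_le_sum) auto
  also have "\<dots> < (\<Sum>f\<in>A. 1 / (2 * real k))"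
  proof (rule sum_strict_mono_ex1)
    have "captured {g} ?O < 1 / (2 * real k)"
    proof -
      have "0 < max 0 (optimal_location k 1 - g) \<or> 0 < max 0 (g - optimal_location k k)"
        using g by linarith
      moreover have "captured {g} ?O \<le> 1 / (2 * real k)
          - max 0 (optimal_location k 1 - g) / 2 - max 0 (g - optimal_location k k) / 2"
        using g assms by (intro captured_optimal_le) auto
      ultimately show ?thesis
        using max.cobounded1[of 0 "optimal_location k 1 - g"]
          max.cobounded1[of 0 "g - optimal_location k k"] by argo
    qed
    then show "\<exists>a\<in>A. captured {a} ?O < 1 / (2 * real k)" using g by blast
  qed (use assms captured_optimal_le_share in auto)
  finally show ?thesis using assms by simp
next
  case True
  let ?O = "optimal_locations k"
  let ?o = "optimal_location k"
  have "\<not> ?O \<subseteq> A"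
    using assms card_subset_eq[of A ?O] by (auto simp: card_optimal_locations)
  then obtain j where j: "1 \<le> j" "j \<le> k" "?o j \<notin> A"
    by (metis atLeastAtMost_iff imageE optimal_locations_eq subsetI)
  \<comment> \<open>Each facility is assigned a gap that contains it. One that sits on an optimal
    location gets the adjacent gap on the side of the vacant o_j, so it never occupies the end of
    its gap that is nearer to o_j.\<close>
  have "\<exists>i\<in>{1..<k}. (f < ?o j \<longrightarrow> ?o i \<le> f \<and> f < ?o (Suc i)) \<and> (?o j < f \<longrightarrow> ?o i < f \<and> f \<le> ?o (Suc i))"
    if f: "f \<in> A" for f
  proof -
    have "?o 1 \<le> f" "f \<le> ?o k" using f True by auto
    with \<open>1 \<le> k\<close> show ?thesis
    proof (cases rule: optimal_location_cases)
      case (on i)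
      then have "i \<noteq> j" using f j by auto
      then consider "i < j" | "j < i" by linarith
      then show ?thesis
      proof cases
        case 1
        then show ?thesis using on j \<open>1 \<le> k\<close>
          by (intro bexI[of _ i]) (auto simp: optimal_location_less_iff)
      next
        case 2
        then show ?thesis using on j \<open>1 \<le> k\<close>
          by (intro bexI[of _ "i - 1"]) (auto simp: optimal_location_less_iff optimal_location_le_iff)
      qed
    next
      case (between i)
      then show ?thesis by (intro bexI[of _ i]) auto
    qed
  qed
  then obtain gap where gap: "\<And>f. f \<in> A \<Longrightarrow> gap f \<in> {1..<k}"
    "\<And>f. f \<in> A \<Longrightarrow> f < ?o j \<Longrightarrow> ?o (gap f) \<le> f \<and> f < ?o (Suc (gap f))"
    "\<And>f. f \<in> A \<Longrightarrow> ?o j < f \<Longrightarrow> ?o (gap f) < f \<and> f \<le> ?o (Suc (gap f))"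
    by metis
  have "card (gap ` A) \<le> card {1..<k}" using gap(1) by (intro card_mono) auto
  also have "\<dots> < card A" using assms by simp
  finally obtain f0 g0 where "f0 \<in> A" "g0 \<in> A" "f0 \<noteq> g0" "gap f0 = gap g0"
    using pigeonhole[of gap A] by (auto simp: inj_on_def)
  then obtain f g where fg: "f \<in> A" "g \<in> A" "f < g" "gap f = gap g"
    by (metis linorder_neqE_linordered_idom)
  define i where "i = gap f"
  have i: "1 \<le> i" "i < k" using gap(1)[of f] fg unfolding i_def by auto
  have ne: "f \<noteq> ?o j" "g \<noteq> ?o j" using fg j by auto
  have bounds: "?o i \<le> f" "f \<le> ?o (Suc i)" "?o i \<le> g" "g \<le> ?o (Suc i)"
    using gap(2,3)[of f] gap(2,3)[of g] ne fg unfolding i_def by (auto simp: neq_iff)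
  \<comment> \<open>If \<open>f\<close> and \<open>g\<close> were the two ends of their common gap,
    the assignment rule would put the vacant o_j strictly between two consecutive optimal
    locations.\<close>
  have "?o i < f \<or> g < ?o (Suc i)"
  proof (rule ccontr)
    assume neg: "\<not> ?thesis"
    then have "f < ?o j" "?o j < g"
      using gap(2,3)[of f] gap(2,3)[of g] ne fg unfolding i_def by (auto simp: neq_iff)
    then have "?o i < ?o j" "?o j < ?o (Suc i)" using bounds by auto
    then show False using \<open>1 \<le> k\<close> by (simp add: optimal_location_less_iff)
  qed
  \<comment> \<open>The catchment areas of \<open>f\<close> and \<open>g\<close> intersect in the
    interval between these points; its length is positive because \<open>g - f\<close> is less than
    the whole gap.\<close>
  then have pq: "(?o i + g) / 2 < (f + ?o (Suc i)) / 2" using bounds by argo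
  have "?o i \<in> ?O" "?o (Suc i) \<in> ?O" using i by (auto intro!: optimal_location_mem)
  then have O01: "0 \<le> ?o i" "?o (Suc i) \<le> 1" using optimal_locations_subset[of k] by auto
  have "captured A ?O < (\<Sum>f\<in>A. captured {f} ?O)"
  proof (rule captured_le_sum_overlap[OF assms(3) _ fg(1,2) _ _ pq])
    fix t assume "(?o i + g) / 2 \<le> t" "t \<le> (f + ?o (Suc i)) / 2"
    then show "market_share {f} ?O t \<ge> 1/2 \<and> market_share {g} ?O t \<ge> 1/2"
      using bounds i \<open>1 \<le> k\<close> fg by (intro conjI market_share_between_optimal[of k i]) auto
  qed (use O01 bounds fg in auto)
  also have "\<dots> \<le> (\<Sum>f\<in>A. 1 / (2 * real k))"
    using assms by (intro sum_mono captured_optimal_le_share) auto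
  finally show ?thesis using assms by simp
qed

section \<open>Facilities against shifted optimal locations\<close>

text \<open>A concave sequence with constant second difference -2, zero at 0 and k and symmetric
  under i -> k - i. The symmetry makes the effects of a shift and of its mirror image cancel at the
  optimal locations.\<close>

definition bump :: "nat \<Rightarrow> nat \<Rightarrow> real" where
  "bump k i = real i * (real k - real i)"

definition shifted_location :: "nat \<Rightarrow> real \<Rightarrow> real \<Rightarrow> nat \<Rightarrow> real" where
  "shifted_location k \<epsilon> \<eta> i = optimal_location k i + \<epsilon> * (bump k i + \<eta>)"

definition shifted_locations :: "nat \<Rightarrow> real \<Rightarrow> real \<Rightarrow> real set" where
  "shifted_locations k \<epsilon> \<eta> = shifted_location k \<epsilon> \<eta> ` {1..k}"

lemma bump_bounds:
  assumes "i \<le> k"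
  shows "0 \<le> bump k i" "bump k i \<le> real k ^ 2"
proof -
  show "0 \<le> bump k i" using assms by (simp add: bump_def)
  have "bump k i \<le> real k * real k" unfolding bump_def using assms by (intro mult_mono) auto
  then show "bump k i \<le> real k ^ 2" by (simp add: power2_eq_square)
qed

text \<open>Since \<open>bump\<close> is at most k^2 and \<eta> at most 1, \<epsilon> (k^2 + 1)
  bounds every shift. The last assumption makes this at most a quarter of the spacing, so no shifted
  location reaches the next optimal one.\<close>

locale small_shift =
  fixes k :: nat and \<epsilon> \<eta> :: real
  assumes k_pos: "1 \<le> k" and \<epsilon>_pos: "0 < \<epsilon>" and \<eta>_pos: "0 < \<eta>" and \<eta>_le_1: "\<eta> \<le> 1"
    and \<epsilon>_small: "\<epsilon> * (real k ^ 2 + 1) \<le> 1 / (4 * real k)"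
begin

abbreviation "loc \<equiv> optimal_location k"
abbreviation "sloc \<equiv> shifted_location k \<epsilon> \<eta>"
abbreviation "R \<equiv> shifted_locations k \<epsilon> \<eta>"
abbreviation "\<delta> \<equiv> \<epsilon> * (real k ^ 2 + 1)"

lemma finite_R [simp]: "finite R"
  by (simp add: shifted_locations_def)

lemma sloc_mem: "1 \<le> i \<Longrightarrow> i \<le> k \<Longrightarrow> sloc i \<in> R"
  by (auto simp: shifted_locations_def)

lemma \<delta>_pos: "0 < \<delta>"
  using \<epsilon>_pos by (intro mult_pos_pos) (auto intro: add_nonneg_pos)

lemma sloc_bounds:
  assumes "i \<le> k"
  shows "loc i < sloc i" "sloc i \<le> loc i + \<delta>"
proof -
  note b = bump_bounds[OF assms]
  show "loc i < sloc i" using b \<epsilon>_pos \<eta>_pos by (simp add: shifted_location_def add_nonneg_pos)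
  have "\<epsilon> * (bump k i + \<eta>) \<le> \<delta>"
    using b \<epsilon>_pos \<eta>_le_1 by (intro mult_left_mono) auto
  then show "sloc i \<le> loc i + \<delta>" by (simp add: shifted_location_def)
qed

lemma gap_half: "loc (Suc i) = loc i + 2 * (1 / (2 * real k))"
  using optimal_location_Suc[OF k_pos, of i] by simp

lemma \<delta>_le: "\<delta> \<le> (1 / (2 * real k)) / 2"
  using \<epsilon>_small by simp

lemma half_gap_pos: "0 < 1 / (2 * real k)"
  using k_pos by simp

lemma sloc_less_next:
  assumes "i \<le> k"
  shows "sloc i < loc (Suc i)"
proof -
  define h where "h = 1 / (2 * real k)"
  show ?thesis
    using sloc_bounds(2)[OF assms] gap_half[of i] \<delta>_le half_gap_pos
    unfolding h_def[symmetric] by linarith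
qed

lemma sloc_less_Suc: "Suc i \<le> k \<Longrightarrow> sloc i < sloc (Suc i)"
  using sloc_less_next[of i] sloc_bounds(1)[of "Suc i"] by linarith

lemma R_subset: "R \<subseteq> {0..1}"
proof
  fix x assume "x \<in> R"
  then obtain i where i: "1 \<le> i" "i \<le> k" "x = sloc i" by (auto simp: shifted_locations_def)
  have "loc 1 \<le> loc i" "loc i \<le> loc k" using i k_pos by (auto simp: optimal_location_le_iff)
  then show "x \<in> {0..1}"
    using i sloc_bounds[of i] \<delta>_le half_gap_pos optimal_location_first[of k] optimal_location_last[OF k_pos]
    by auto
qed

lemma card_R: "card R = k"
proof -
  have "sloc i < sloc j" if "i < j" "j \<le> k" for i j
    using that
  proof (induction j)
    case (Suc j)
    then show ?case using sloc_less_Suc[of j] by (cases "i = j") (auto simp: less_Suc_eq)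
  qed simp
  then have "inj_on sloc {1..k}"
    by (intro linorder_inj_onI) (auto simp: order_less_le)
  then show ?thesis by (simp add: shifted_locations_def card_image)
qed

section \<open>Capture bounds against the right shift\<close>

text \<open>All shifts are positive, so o_i is vacant and lies between \<open>sloc (i - 1)\<close>
  and \<open>sloc i\<close>, whose distance is halved. Both carry the same \<eta>, which cancels
  except at i = 1, where the left border is the fixed end 0.\<close>

lemma captured_at_location:
  assumes "1 \<le> i" "i \<le> k"
  shows "captured {loc i} R \<le> 1 / (2 * real k) + \<epsilon> / 2 * (bump k i - bump k (i - 1) + \<eta>)"
proof -
  have up: "upper_cutoff R (loc i) ((loc i + sloc i) / 2)"
    using assms sloc_bounds(1)[of i] by (intro upper_cutoffI[of "sloc i"] sloc_mem) auto
  show ?thesis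
  proof (cases "i = 1")
    case True
    have "0 < loc i" using True half_gap_pos by (simp add: optimal_location_first)
    then have "captured {loc i} R \<le> (loc i + sloc i) / 2 - 0"
      using up assms sloc_bounds(1)[of i] by (intro captured_singleton_le lower_cutoff_0) auto
    also have "\<dots> = 1 / (2 * real k) + \<epsilon> / 2 * (bump k i - bump k (i - 1) + \<eta>)"
      using True by (simp add: shifted_location_def optimal_location_first bump_def field_simps)
    finally show ?thesis .
  next
    case False
    then obtain j where j: "i = Suc j" "1 \<le> j" using assms by (cases i) auto
    have "sloc j < loc i" "loc i < sloc i" using sloc_less_next[of j] sloc_bounds(1)[of i] assms j by auto
    then have "captured {loc i} R \<le> (loc i + sloc i) / 2 - (sloc j + loc i) / 2"
      using up assms j by (intro captured_singleton_le lower_cutoffI[of "sloc j"] sloc_mem) auto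
    also have "\<dots> = (sloc i - sloc j) / 2" by argo
    also have "\<dots> \<le> 1 / (2 * real k) + \<epsilon> / 2 * (bump k i - bump k j + \<eta>)"
      using gap_half[of j] \<epsilon>_pos \<eta>_pos unfolding j(1) shifted_location_def by (simp add: field_simps)
    finally show ?thesis by (simp add: j)
  qed
qed

text \<open>The neighbours are two consecutive shifted locations, and half their distance is
  captured wherever \<open>f\<close> stands between them.\<close>

lemma captured_past_shift:
  assumes "1 \<le> i" "i < k" "sloc i < f" "f < loc (Suc i)"
  shows "captured {f} R \<le> 1 / (2 * real k) + \<epsilon> / 2 * (bump k (Suc i) - bump k i)"
proof -
  have "f < sloc (Suc i)" using assms sloc_bounds(1)[of "Suc i"] by auto
  then have "captured {f} R \<le> (f + sloc (Suc i)) / 2 - (sloc i + f) / 2"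
    using assms
    by (intro captured_singleton_le lower_cutoffI[of "sloc i"] upper_cutoffI[of "sloc (Suc i)"] sloc_mem) auto
  also have "\<dots> = (sloc (Suc i) - sloc i) / 2" by argo
  also have "\<dots> = 1 / (2 * real k) + \<epsilon> / 2 * (bump k (Suc i) - bump k i)"
    using gap_half[of i] unfolding shifted_location_def by (simp add: field_simps)
  finally show ?thesis .
qed

text \<open>A crude bound with no assumption on the side of \<open>sloc i\<close>. It serves
  facilities within \<delta> of an optimal location, a region that shrinks away in the
  limit.\<close>

lemma captured_between:
  assumes "1 \<le> i" "i < k" "loc i < f" "f < loc (Suc i)"
  shows "captured {f} R \<le> 1 / (2 * real k) + \<delta>"
proof -
  let ?h = "1 / (2 * real k)"
  have fs: "f < sloc (Suc i)" "loc (Suc i) < sloc (Suc i)" "sloc (Suc i) \<le> loc (Suc i) + \<delta>"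
    and si: "loc i < sloc i" "sloc i \<le> loc i + \<delta>"
    using assms sloc_bounds[of "Suc i"] sloc_bounds[of i] by auto
  consider "sloc i < f" | "f = sloc i" | "f < sloc i" by linarith
  then show ?thesis
  proof cases
    case 1
    have "captured {f} R \<le> (f + sloc (Suc i)) / 2 - (sloc i + f) / 2"
      using assms 1 fs
      by (intro captured_singleton_le lower_cutoffI[of "sloc i"] upper_cutoffI[of "sloc (Suc i)"] sloc_mem) auto
    then show ?thesis using fs si gap_half[of i] \<delta>_pos by argo
  next
    case 2
    \<comment> \<open>On the spot \<open>sloc i\<close> itself the catchment spans both adjacent
      gaps, but it is shared, so about 1/(2k) remains.\<close>
    have up: "upper_cutoff R f ((f + sloc (Suc i)) / 2)"
      using assms fs by (intro upper_cutoffI[of "sloc (Suc i)"] sloc_mem) auto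
    show ?thesis
    proof (cases "i = 1")
      case True
      have "0 < loc i" using True half_gap_pos by (simp add: optimal_location_first)
      then have "captured {f} R \<le> ((f + sloc (Suc i)) / 2 - 0) / 2"
        using assms fs 2 up by (intro captured_occupied_le lower_cutoff_0) (auto simp: sloc_mem)
      then show ?thesis using 2 fs si gap_half[of i] optimal_location_first[of k] \<delta>_pos
        unfolding True One_nat_def by argo
    next
      case False
      then obtain j where j: "i = Suc j" "1 \<le> j" using assms by (cases i) auto
      have "sloc j < loc i" "loc j < sloc j" using sloc_less_next[of j] sloc_bounds(1)[of j] assms j by auto
      then have "captured {f} R \<le> ((f + sloc (Suc i)) / 2 - (sloc j + f) / 2) / 2"
        using assms fs 2 up j
        by (intro captured_occupied_le lower_cutoffI[of "sloc j"]) (auto simp: sloc_mem)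
      then show ?thesis using \<open>loc j < sloc j\<close> fs si gap_half[of i] gap_half[of j] \<delta>_pos
        unfolding j(1) by argo
    qed
  next
    case 3
    \<comment> \<open>Here \<open>f\<close> has not passed \<open>sloc i\<close>, so its left
      neighbour is \<open>sloc (i - 1)\<close>, or the end 0 when i = 1.\<close>
    have up: "upper_cutoff R f ((f + sloc i) / 2)"
      using assms 3 by (intro upper_cutoffI[of "sloc i"] sloc_mem) auto
    show ?thesis
    proof (cases "i = 1")
      case True
      have "0 < loc i" using True half_gap_pos by (simp add: optimal_location_first)
      then have "captured {f} R \<le> (f + sloc i) / 2 - 0"
        using assms 3 up by (intro captured_singleton_le lower_cutoff_0) auto
      then show ?thesis using 3 si optimal_location_first[of k] \<delta>_pos
        unfolding True One_nat_def by argo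
    next
      case False
      then obtain j where j: "i = Suc j" "1 \<le> j" using assms by (cases i) auto
      have "sloc j < loc i" "loc j < sloc j" using sloc_less_next[of j] sloc_bounds(1)[of j] assms j by auto
      then have "captured {f} R \<le> (f + sloc i) / 2 - (sloc j + f) / 2"
        using assms 3 up j
        by (intro captured_singleton_le lower_cutoffI[of "sloc j"] sloc_mem) auto
      then show ?thesis using \<open>loc j < sloc j\<close> si gap_half[of j] \<delta>_pos
        unfolding j(1) by argo
    qed
  qed
qed

section \<open>The mirrored shift and both shifts together\<close>

abbreviation "L \<equiv> (\<lambda>x. 1 - x) ` R"

lemma captured_L: "captured {f} L = captured {1 - f} R"
  using captured_reflect[of "{1 - f}" R] by simp

lemma L_subset: "L \<subseteq> {0..1}"
  using R_subset by auto

lemma card_L: "card L = k"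
  using card_R by (subst card_image) (auto simp: inj_on_def)

text \<open>Facing \<open>L\<close> at \<open>f\<close> amounts to facing \<open>R\<close> at
  \<open>1 - f\<close>. At o_i the two increments of \<open>bump\<close> are opposite, leaving twice
  \<epsilon> \<eta> / 2. Away from all optimal locations they add up to the second difference -2, so
  the excess is -\<epsilon>. Near one, \<open>captured_between\<close> is used twice and costs 2
  \<delta>.\<close>

lemma captured_R_plus_L_le:
  assumes "loc 1 \<le> f" "f \<le> loc k"
  shows "captured {f} R + captured {f} L \<le> 1 / real k + \<epsilon> *
    (if f \<in> optimal_locations k then \<eta>
     else if \<forall>i\<in>{1..k}. \<delta> < \<bar>f - loc i\<bar> then - 1 else 2 * (real k ^ 2 + 1))"
  using k_pos assms
proof (cases rule: optimal_location_cases)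
  case (on i)
  have refl: "1 - loc i = loc (Suc k - i)" using on k_pos by (simp add: optimal_location_reflect)
  have "bump k (Suc k - i) = bump k (i - 1)" "bump k (Suc k - i - 1) = bump k i"
    using on by (simp_all add: bump_def of_nat_diff algebra_simps)
  then have "captured {f} L \<le> 1 / (2 * real k) + \<epsilon> / 2 * (bump k (i - 1) - bump k i + \<eta>)"
    using captured_at_location[of "Suc k - i"] on refl by (simp add: captured_L)
  moreover have "captured {f} R \<le> 1 / (2 * real k) + \<epsilon> / 2 * (bump k i - bump k (i - 1) + \<eta>)"
    using captured_at_location[of i] on by simp
  moreover have "f \<in> optimal_locations k" using on by (simp add: optimal_location_mem)
  ultimately show ?thesis by (simp add: field_simps)
next
  case (between i)
  have notin: "f \<notin> optimal_locations k"
    using between k_pos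
    by (auto simp: optimal_locations_eq optimal_location_less_iff)
  have refl: "1 - loc (Suc i) = loc (k - i)" "1 - loc i = loc (Suc (k - i))"
    using between k_pos by (simp_all add: optimal_location_reflect Suc_diff_le)
  then have between': "1 \<le> k - i" "k - i < k" "loc (k - i) < 1 - f" "1 - f < loc (Suc (k - i))"
    using between by auto
  show ?thesis
  proof (cases "\<forall>i\<in>{1..k}. \<delta> < \<bar>f - loc i\<bar>")
    case True
    have "sloc i < f"
      using True between sloc_bounds[of i] by force
    then have "captured {f} R \<le> 1 / (2 * real k) + \<epsilon> / 2 * (bump k (Suc i) - bump k i)"
      using between by (intro captured_past_shift) auto
    moreover have "\<delta> < \<bar>f - loc (Suc i)\<bar>" using bspec[OF True, of "Suc i"] between by auto
    then have "sloc (k - i) < 1 - f"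
      using between refl sloc_bounds[of "k - i"] by auto
    then have "captured {f} L \<le> 1 / (2 * real k) + \<epsilon> / 2 * (bump k (Suc (k - i)) - bump k (k - i))"
      unfolding captured_L using between' by (intro captured_past_shift) auto
    moreover have "bump k (Suc i) - bump k i + (bump k (Suc (k - i)) - bump k (k - i)) = - 2"
      using between by (simp add: bump_def of_nat_diff algebra_simps)
    then have "\<epsilon> / 2 * (bump k (Suc i) - bump k i) + \<epsilon> / 2 * (bump k (Suc (k - i)) - bump k (k - i)) = - \<epsilon>"
      unfolding distrib_left[symmetric] by simp
    moreover have "1 / real k = 1 / (2 * real k) + 1 / (2 * real k)" by simp
    ultimately show ?thesis using True notin by auto
  next
    case False
    have "captured {f} R \<le> 1 / (2 * real k) + \<delta>" using between by (rule captured_between)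
    moreover have "captured {f} L \<le> 1 / (2 * real k) + \<delta>"
      unfolding captured_L using between' by (rule captured_between)
    ultimately show ?thesis using False notin by (auto simp: field_simps)
  qed
qed

end

section \<open>Expected payoffs\<close>

lemma nearest_dist_Un:
  assumes "finite A" "A \<noteq> {}" "finite B" "B \<noteq> {}"
  shows "nearest_dist (A \<union> B) t = min (nearest_dist A t) (nearest_dist B t)"
  unfolding nearest_dist_def image_Un using assms by (intro Min_Un) auto

lemma finite_facilities [simp]: "finite (facilities n s)"
  by (simp add: facilities_def)

lemma facilities_nonempty: "1 \<le> n \<Longrightarrow> facilities n s \<noteq> {}"
  by (auto simp: facilities_def)

lemma nearest_players_eq:
  assumes "1 \<le> l" "1 \<le> k"
  shows "nearest_players l k s t =
    (let a = nearest_dist (facilities l (fst s)) t; b = nearest_dist (facilities k (snd s)) t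
     in if a < b then {1} else if b < a then {2} else {1, 2})"
proof -
  have "nearest_players l k s t = {i \<in> {1, 2}.
      (if i = 1 then nearest_dist (facilities l (fst s)) t else nearest_dist (facilities k (snd s)) t)
      \<le> nearest_dist (facilities l (fst s) \<union> facilities k (snd s)) t}"
    unfolding nearest_players_def player_facilities_def nearest_dist_def by (rule Collect_cong) auto
  then show ?thesis
    using assms by (auto simp: nearest_dist_Un facilities_nonempty Let_def)
qed

lemma payoff_1:
  assumes "1 \<le> l" "1 \<le> k"
  shows "payoff l k 1 s = captured (facilities l (fst s)) (facilities k (snd s))"
  unfolding payoff_def captured_def
  by (rule arg_cong[where f = "set_lebesgue_integral lborel {0..1}"])
    (auto simp: nearest_players_eq[OF assms] market_share_def Let_def fun_eq_iff)

lemma payoff_2: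
  assumes "1 \<le> l" "1 \<le> k"
  shows "payoff l k 2 s = captured (facilities k (snd s)) (facilities l (fst s))"
  unfolding payoff_def captured_def
  by (rule arg_cong[where f = "set_lebesgue_integral lborel {0..1}"])
    (auto simp: nearest_players_eq[OF assms] market_share_def Let_def fun_eq_iff)

lemma strategies_facilities:
  assumes "s \<in> strategies n"
  shows "facilities n s \<subseteq> {0..1}" "card (facilities n s) = n"
proof -
  show "facilities n s \<subseteq> {0..1}"
    using assms by (auto simp: strategies_def facilities_def PiE_iff)
  have "inj_on s {1..n}"
    using assms by (auto simp: strategies_def intro: strict_mono_on_imp_inj_on)
  then show "card (facilities n s) = n" by (simp add: facilities_def card_image)
qed

lemma sum_facilities:
  "s \<in> strategies n \<Longrightarrow> (\<Sum>f\<in>facilities n s. g f) = (\<Sum>i=1..n. g (s i))"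
  unfolding facilities_def strategies_def
  by (subst sum.reindex) (auto intro: strict_mono_on_imp_inj_on)

lemma strategy_with_facilities:
  assumes "finite A" "A \<subseteq> {0..1}" "card A = n"
  obtains s where "s \<in> strategies n" "facilities n s = A"
proof
  let ?xs = "sorted_list_of_set A"
  \<comment> \<open>The increasing enumeration of \<open>A\<close>; lists count from 0, strategies
    from 1.\<close>
  let ?s = "\<lambda>i\<in>{1..n}. ?xs ! (i - 1)"
  have len: "length ?xs = n" using assms by simp
  have "facilities n ?s = (!) ?xs ` (\<lambda>i. i - 1) ` {1..n}"
    by (simp add: facilities_def image_image)
  also have "(\<lambda>i. i - 1) ` {1..n} = {0..<n}"
    by (force intro: image_eqI[of _ _ "Suc _"])
  also have "(!) ?xs ` {0..<n} = A"
    using assms len nth_image[of n ?xs] by simp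
  finally show A: "facilities n ?s = A" .
  have "?xs ! (i - 1) < ?xs ! (j - 1)" if "1 \<le> i" "i < j" "j \<le> n" for i j
    using that len by (intro sorted_wrt_nth_less[OF strict_sorted_list_of_set]) auto
  then have "strict_mono_on {1..n} ?s" by (auto simp: strict_mono_on_def)
  moreover have "?s \<in> {1..n} \<rightarrow>\<^sub>E {0..1}"
    using A assms(2) by (auto simp: facilities_def)
  ultimately show "?s \<in> strategies n" by (simp add: strategies_def)
qed

section \<open>Measurability of payoffs\<close>

lemma space_strategy_space: "space (strategy_space n) = strategies n"
  by (auto simp: strategy_space_def space_restrict_space space_PiM strategies_def)

lemma measurable_coordinate:
  "i \<in> {1..n} \<Longrightarrow> (\<lambda>s. s i) \<in> borel_measurable (strategy_space n)"
  unfolding strategy_space_def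
  by (intro measurable_restrict_space1 measurable_component_singleton)

lemma mixed_strategiesD:
  assumes "x \<in> mixed_strategies n"
  shows "prob_space x" "sets x = sets (strategy_space n)" "space x = strategies n"
  using assms sets_eq_imp_space_eq[of x "strategy_space n"]
  by (auto simp: mixed_strategies_def space_strategy_space)

lemma point_mass_mixed:
  "s \<in> strategies n \<Longrightarrow> return (strategy_space n) s \<in> mixed_strategies n"
  by (simp add: mixed_strategies_def prob_space_return space_strategy_space)

text \<open>The location set varies with the point, so the minimum is taken over the fixed index set
  instead, each coordinate being measurable.\<close>

lemma borel_measurable_nearest_dist_facilities:
  assumes "1 \<le> n" "h \<in> measurable M (strategy_space n)" "g \<in> borel_measurable M"
  shows "(\<lambda>w. nearest_dist (facilities n (h w)) (g w)) \<in> borel_measurable M"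
proof -
  have [measurable]: "(\<lambda>w. h w i) \<in> borel_measurable M" if "i \<in> {1..n}" for i
    using measurable_compose[OF assms(2) measurable_coordinate[OF that]] .
  have "(\<lambda>w. Min ((\<lambda>i. \<bar>g w - h w i\<bar>) ` {1..n})) \<in> borel_measurable M"
    using assms(3) by (intro borel_measurable_Min borel_measurable_abs borel_measurable_diff) auto
  then show ?thesis by (simp add: nearest_dist_def facilities_def image_image)
qed

text \<open>The share is jointly measurable in both strategies and the customer; integrating out the
  customer keeps measurability.\<close>

lemma borel_measurable_captured:
  assumes "1 \<le> l" "1 \<le> k"
  shows "(\<lambda>(s1, s2). captured (facilities l s1) (facilities k s2))
    \<in> borel_measurable (strategy_space l \<Otimes>\<^sub>M strategy_space k)"
proof -
  let ?P = "(strategy_space l \<Otimes>\<^sub>M strategy_space k) \<Otimes>\<^sub>M (lborel :: real measure)"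
  have [measurable]:
    "(\<lambda>w. nearest_dist (facilities l (fst (fst w))) (snd w)) \<in> borel_measurable ?P"
    "(\<lambda>w. nearest_dist (facilities k (snd (fst w))) (snd w)) \<in> borel_measurable ?P"
    by (intro borel_measurable_nearest_dist_facilities assms; measurable)+
  have "(\<lambda>(s, t). indicator {0..1} t * market_share (facilities l (fst s)) (facilities k (snd s)) t)
      \<in> borel_measurable ?P"
    unfolding market_share_def split_beta by measurable
  then have "(\<lambda>s. \<integral>t. indicator {0..1} t * market_share (facilities l (fst s)) (facilities k (snd s)) t \<partial>lborel)
    \<in> borel_measurable (strategy_space l \<Otimes>\<^sub>M strategy_space k)"
    by (rule lborel.borel_measurable_lebesgue_integral)
  then show ?thesis
    by (simp add: captured_def set_lebesgue_integral_def split_beta)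
qed

section \<open>Payoffs of mixed profiles\<close>

text \<open>No equilibrium is assumed, so profiles in which one player deviates to a point mass are
  instances as well.\<close>

locale mixed_profile =
  fixes l k :: nat and x1 x2 :: "(nat \<Rightarrow> real) measure"
  assumes l_pos: "1 \<le> l" and k_pos: "1 \<le> k"
    and x1: "x1 \<in> mixed_strategies l" and x2: "x2 \<in> mixed_strategies k"
begin

sublocale X1: prob_space x1 using x1 by (rule mixed_strategiesD)
sublocale X2: prob_space x2 using x2 by (rule mixed_strategiesD)
sublocale P: pair_prob_space x1 x2 ..

abbreviation "gain s1 s2 \<equiv> captured (facilities l s1) (facilities k s2)"

lemma gain_measurable [measurable]: "(\<lambda>(s1, s2). gain s1 s2) \<in> borel_measurable (x1 \<Otimes>\<^sub>M x2)"
proof -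
  have "sets (x1 \<Otimes>\<^sub>M x2) = sets (strategy_space l \<Otimes>\<^sub>M strategy_space k)"
    by (intro sets_pair_measure_cong mixed_strategiesD x1 x2)
  then show ?thesis
    using borel_measurable_captured[OF l_pos k_pos] by (simp cong: measurable_cong_sets)
qed

lemma gain_integrable: "integrable (x1 \<Otimes>\<^sub>M x2) (\<lambda>(s1, s2). gain s1 s2)"
  by (rule P.integrable_const_bound[where B = 1]) (auto simp: captured_bounds)

lemma gain_integrable_2: "s1 \<in> strategies l \<Longrightarrow> integrable x2 (\<lambda>s2. gain s1 s2)"
  using mixed_strategiesD(3)[OF x1] measurable_Pair2[OF gain_measurable, of s1]
  by (intro X2.integrable_const_bound[where B = 1]) (auto simp: captured_bounds)

lemma gain_integrable_1: "s2 \<in> strategies k \<Longrightarrow> integrable x1 (\<lambda>s1. gain s1 s2)"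
  using mixed_strategiesD(3)[OF x2] measurable_Pair1[OF gain_measurable, of s2]
  by (intro X1.integrable_const_bound[where B = 1]) (auto simp: captured_bounds)

lemma expected_payoff_1: "expected_payoff l k 1 x1 x2 = (\<integral>s1. \<integral>s2. gain s1 s2 \<partial>x2 \<partial>x1)"
proof -
  have "expected_payoff l k 1 x1 x2 = integral\<^sup>L (x1 \<Otimes>\<^sub>M x2) (\<lambda>(s1, s2). gain s1 s2)"
    unfolding expected_payoff_def payoff_1[OF l_pos k_pos] by (simp add: case_prod_unfold)
  then show ?thesis using P.integral_fst'[OF gain_integrable] by simp
qed

text \<open>The game is constant-sum; this turns the equilibrium condition of player 2 into lower
  bounds on the payoff of player 1.\<close>

lemma expected_payoff_2: "expected_payoff l k 2 x1 x2 = 1 - expected_payoff l k 1 x1 x2"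
proof -
  have "expected_payoff l k 2 x1 x2 = integral\<^sup>L (x1 \<Otimes>\<^sub>M x2) (\<lambda>s. 1 - (\<lambda>(s1, s2). gain s1 s2) s)"
    unfolding expected_payoff_def payoff_2[OF l_pos k_pos]
    by (intro Bochner_Integration.integral_cong) (auto intro!: captured_complement)
  also have "\<dots> = 1 - integral\<^sup>L (x1 \<Otimes>\<^sub>M x2) (\<lambda>(s1, s2). gain s1 s2)"
    using gain_integrable by (subst Bochner_Integration.integral_diff) (auto simp: P.prob_space)
  finally show ?thesis
    unfolding expected_payoff_def payoff_1[OF l_pos k_pos] by (simp add: case_prod_unfold)
qed

end

lemma expected_payoff_point_mass_1:
  assumes "1 \<le> l" "1 \<le> k" "s \<in> strategies l" "x2 \<in> mixed_strategies k"
  shows "expected_payoff l k 1 (return (strategy_space l) s) x2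
    = (\<integral>s2. captured (facilities l s) (facilities k s2) \<partial>x2)"
proof -
  interpret mixed_profile l k "return (strategy_space l) s" x2
    by unfold_locales (use assms point_mass_mixed in auto)
  have "(\<lambda>s1. \<integral>s2. gain s1 s2 \<partial>x2) \<in> borel_measurable (strategy_space l)"
    using X2.borel_measurable_lebesgue_integral[OF gain_measurable]
    by (simp cong: measurable_cong_sets)
  then show ?thesis
    unfolding expected_payoff_1 using assms(3)
    by (subst integral_return) (auto simp: space_strategy_space)
qed

lemma expected_payoff_point_mass_2:
  assumes "1 \<le> l" "1 \<le> k" "s \<in> strategies k" "x1 \<in> mixed_strategies l"
  shows "expected_payoff l k 1 x1 (return (strategy_space k) s)
    = (\<integral>s1. captured (facilities l s1) (facilities k s) \<partial>x1)"
proof -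
  interpret mixed_profile l k x1 "return (strategy_space k) s"
    by unfold_locales (use assms point_mass_mixed in auto)
  have "(\<integral>s2. gain s1 s2 \<partial>return (strategy_space k) s) = gain s1 s" if "s1 \<in> space x1" for s1
    using that assms(3) measurable_Pair2[OF gain_measurable, of s1]
    by (subst integral_return) (auto simp: space_strategy_space)
  then show ?thesis
    unfolding expected_payoff_1 by (intro Bochner_Integration.integral_cong) auto
qed

section \<open>Equilibria\<close>

lemma card_subsets_containing:
  assumes "finite T" "x \<in> T" "1 \<le> l"
  shows "card {A. A \<subseteq> T \<and> card A = l \<and> x \<in> A} = (card T - 1) choose (l - 1)"
proof -
  have "{A. A \<subseteq> T \<and> card A = l \<and> x \<in> A} = insert x ` {A. A \<subseteq> T - {x} \<and> card A = l - 1}"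
  proof (intro equalityI subsetI)
    fix A assume A: "A \<in> {A. A \<subseteq> T \<and> card A = l \<and> x \<in> A}"
    then have "A = insert x (A - {x})" "card (A - {x}) = l - 1"
      using assms finite_subset[of A T] by auto
    with A show "A \<in> insert x ` {A. A \<subseteq> T - {x} \<and> card A = l - 1}" by blast
  next
    fix A assume "A \<in> insert x ` {A. A \<subseteq> T - {x} \<and> card A = l - 1}"
    then obtain A' where "A' \<subseteq> T - {x}" "card A' = l - 1" "A = insert x A'" by blast
    moreover have "finite A'" using \<open>A' \<subseteq> T - {x}\<close> assms(1) by (meson finite_Diff finite_subset)
    moreover have "x \<notin> A'" using \<open>A' \<subseteq> T - {x}\<close> by blast
    ultimately show "A \<in> {A. A \<subseteq> T \<and> card A = l \<and> x \<in> A}" using assms by auto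
  qed
  moreover have "inj_on (insert x) {A. A \<subseteq> T - {x} \<and> card A = l - 1}"
    by (rule inj_onI) (metis (no_types, lifting) Diff_insert_absorb insert_Diff_single mem_Collect_eq subset_Diff_insert)
  ultimately show ?thesis
    using assms by (simp add: card_image n_subsets)
qed

text \<open>Each customer is served by some \<open>x \<in> T\<close>, and already the \<open>l\<close>-subsets containing \<open>x\<close> secure
  that customer.\<close>

lemma captured_subsets_ge:
  assumes "finite T" "T \<noteq> {}" "finite B" "1 \<le> l"
  shows "real ((card T - 1) choose (l - 1)) * captured T B \<le> (\<Sum>A | A \<subseteq> T \<and> card A = l. captured A B)"
proof -
  let ?\<A> = "{A. A \<subseteq> T \<and> card A = l}" and ?c = "real ((card T - 1) choose (l - 1))"
  have fin: "finite ?\<A>" "\<And>A. A \<in> ?\<A> \<Longrightarrow> finite A"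
    using assms(1) by (auto intro: finite_subset)
  have pw: "?c * market_share T B t \<le> (\<Sum>A\<in>?\<A>. market_share A B t)" for t
  proof -
    obtain x where x: "x \<in> T" "market_share T B t = market_share {x} B t"
      using market_share_attained[OF assms(1,2)] by blast
    have "?c * market_share T B t = (\<Sum>A | A \<subseteq> T \<and> card A = l \<and> x \<in> A. market_share {x} B t)"
      using card_subsets_containing[OF assms(1) x(1) assms(4)] x(2) by simp
    also have "\<dots> \<le> (\<Sum>A | A \<subseteq> T \<and> card A = l \<and> x \<in> A. market_share A B t)"
      using fin(2) by (intro sum_mono market_share_member) auto
    also have "\<dots> \<le> (\<Sum>A\<in>?\<A>. market_share A B t)"
      using fin(1) by (intro sum_mono2) (auto simp: market_share_bounds)
    finally show ?thesis .
  qed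
  have int: "integrable lborel (\<lambda>t. indicator {0..1} t *\<^sub>R market_share A B t)" if "A \<in> ?\<A>" for A
    using set_integrable_market_share[OF fin(2)[OF that] assms(3)] by (simp add: set_integrable_def)
  have "?c * captured T B = (LBINT t:{0..1}. ?c * market_share T B t)"
    by (simp add: captured_def)
  also have "\<dots> \<le> (LBINT t:{0..1}. \<Sum>A\<in>?\<A>. market_share A B t)"
  proof (rule set_integral_mono)
    show "set_integrable lborel {0..1} (\<lambda>t. ?c * market_share T B t)"
      using assms by simp
    show "set_integrable lborel {0..1} (\<lambda>t. \<Sum>A\<in>?\<A>. market_share A B t)"
      unfolding set_integrable_def scaleR_sum_right
      by (intro Bochner_Integration.integrable_sum int)
  qed (rule pw)
  also have "\<dots> = (\<Sum>A\<in>?\<A>. captured A B)"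
    unfolding captured_def set_lebesgue_integral_def scaleR_sum_right
    by (rule Bochner_Integration.integral_sum) (rule int)
  finally show ?thesis .
qed

text \<open>Turns extremal payoffs into almost sure statements: the almost surely nonnegative f - c
  has integral at most 0.\<close>

lemma (in prob_space) AE_eq_of_integral_le:
  fixes f :: "'a \<Rightarrow> real"
  assumes "integrable M f" "AE x in M. c \<le> f x" "integral\<^sup>L M f \<le> c"
  shows "AE x in M. f x = c"
proof -
  have int: "integrable M (\<lambda>x. f x - c)" using assms(1) by simp
  have nn: "AE x in M. 0 \<le> f x - c" using assms(2) by auto
  have "integral\<^sup>L M (\<lambda>x. f x - c) = integral\<^sup>L M f - c"
    using assms(1) by (simp add: prob_space)
  then have "integral\<^sup>L M (\<lambda>x. f x - c) = 0"
    using assms(3) integral_nonneg_AE[OF nn] by linarith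
  then have "AE x in M. f x - c = 0" using integral_nonneg_eq_0_iff_AE[OF int nn] by blast
  then show ?thesis by auto
qed

section \<open>Value of the game and the strategy of player 2\<close>

locale equilibrium = mixed_profile +
  assumes l_le_k: "l \<le> k" and nash: "nash_equilibrium l k x1 x2"
begin

abbreviation "v \<equiv> expected_payoff l k 1 x1 x2"
abbreviation "O_k \<equiv> optimal_locations k"

lemma gain_le_value:
  assumes "A \<subseteq> {0..1}" "finite A" "card A = l"
  shows "(\<integral>s2. captured A (facilities k s2) \<partial>x2) \<le> v"
    and "integrable x2 (\<lambda>s2. captured A (facilities k s2))"
proof -
  obtain s where s: "s \<in> strategies l" "facilities l s = A"
    using strategy_with_facilities assms by metis
  have "expected_payoff l k 1 (return (strategy_space l) s) x2 \<le> v"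
    using nash point_mass_mixed[OF s(1)] by (auto simp: nash_equilibrium_def)
  then show "(\<integral>s2. captured A (facilities k s2) \<partial>x2) \<le> v"
    using expected_payoff_point_mass_1[OF l_pos k_pos s(1) x2] s(2) by simp
  show "integrable x2 (\<lambda>s2. captured A (facilities k s2))"
    using gain_integrable_2[OF s(1)] s(2) by simp
qed

lemma gain_ge_value:
  assumes "B \<subseteq> {0..1}" "finite B" "card B = k"
  shows "v \<le> (\<integral>s1. captured (facilities l s1) B \<partial>x1)"
    and "integrable x1 (\<lambda>s1. captured (facilities l s1) B)"
proof -
  obtain s where s: "s \<in> strategies k" "facilities k s = B"
    using strategy_with_facilities assms by metis
  interpret dev: mixed_profile l k x1 "return (strategy_space k) s"
    using l_pos k_pos x1 point_mass_mixed[OF s(1)] by unfold_locales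
  have "expected_payoff l k 2 x1 (return (strategy_space k) s) \<le> expected_payoff l k 2 x1 x2"
    using nash point_mass_mixed[OF s(1)] by (auto simp: nash_equilibrium_def)
  then have "v \<le> expected_payoff l k 1 x1 (return (strategy_space k) s)"
    by (simp add: expected_payoff_2 dev.expected_payoff_2)
  then show "v \<le> (\<integral>s1. captured (facilities l s1) B \<partial>x1)"
    using expected_payoff_point_mass_2[OF l_pos k_pos s(1) x1] s(2) by simp
  show "integrable x1 (\<lambda>s1. captured (facilities l s1) B)"
    using gain_integrable_1[OF s(1)] s(2) by simp
qed

lemma integrable_captured_optimal: "integrable x2 (\<lambda>s2. captured O_k (facilities k s2))"
proof -
  obtain o' where o': "o' \<in> strategies k" "facilities k o' = O_k"
    using strategy_with_facilities[OF finite_optimal_locations optimal_locations_subset card_optimal_locations] .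
  \<comment> \<open>o^k has \<open>k\<close> facilities and in general is no strategy of player 1,
    so integrability is taken from the \<open>k\<close> vs \<open>k\<close> game.\<close>
  have kk: "mixed_profile k k x2 x2" using k_pos x2 by unfold_locales
  show ?thesis using mixed_profile.gain_integrable_2[OF kk o'(1)] o'(2) by simp
qed

text \<open>Every \<open>l\<close>-subset of o^k is a deviation of player 1 and earns at most
  \<open>v\<close>. Summing over all of them and applying \<open>captured_subsets_ge\<close> leaves
  the ratio of \<open>(k - 1) choose (l - 1)\<close> to \<open>k choose l\<close>, which is
  l/k.\<close>

lemma value_ge: "real l / real k * (\<integral>s2. captured O_k (facilities k s2) \<partial>x2) \<le> v"
proof -
  let ?\<A> = "{A. A \<subseteq> O_k \<and> card A = l}"
  let ?I = "\<integral>s2. captured O_k (facilities k s2) \<partial>x2"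
  let ?c = "real ((k - 1) choose (l - 1))"
  have \<A>: "A \<subseteq> {0..1}" "finite A" "card A = l" if "A \<in> ?\<A>" for A
    using that optimal_locations_subset[of k] finite_subset[OF _ finite_optimal_locations, of A k] by blast+
  have "?c * ?I = (\<integral>s2. ?c * captured O_k (facilities k s2) \<partial>x2)" by simp
  also have "\<dots> \<le> (\<integral>s2. (\<Sum>A\<in>?\<A>. captured A (facilities k s2)) \<partial>x2)"
  proof (rule integral_mono)
    show "integrable x2 (\<lambda>s2. ?c * captured O_k (facilities k s2))" using integrable_captured_optimal by simp
    show "integrable x2 (\<lambda>s2. \<Sum>A\<in>?\<A>. captured A (facilities k s2))"
      by (intro Bochner_Integration.integrable_sum gain_le_value \<A>)
    show "?c * captured O_k (facilities k s2) \<le> (\<Sum>A\<in>?\<A>. captured A (facilities k s2))" for s2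
      using captured_subsets_ge[of O_k "facilities k s2" l] l_pos k_pos optimal_location_mem[of 1 k]
      by (auto simp: card_optimal_locations)
  qed
  also have "\<dots> = (\<Sum>A\<in>?\<A>. \<integral>s2. captured A (facilities k s2) \<partial>x2)"
    by (intro Bochner_Integration.integral_sum gain_le_value \<A>)
  also have "\<dots> \<le> (\<Sum>A\<in>?\<A>. v)" by (intro sum_mono gain_le_value \<A>)
  also have "\<dots> = real (k choose l) * v" by (simp add: n_subsets card_optimal_locations)
  finally have le: "?c * ?I \<le> real (k choose l) * v" .
  have "l * (k choose l) = k * ((k - 1) choose (l - 1))"
    using l_pos by (intro times_binomial_minus1_eq) simp
  then have "real l * real (k choose l) = real k * ?c" by (metis of_nat_mult)
  then have "real (k choose l) * (real l * ?I) = real k * (?c * ?I)"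
    by (metis mult.assoc mult.commute)
  also have "\<dots> \<le> real k * (real (k choose l) * v)" using le by (intro mult_left_mono) auto
  finally have "real (k choose l) * (real l * ?I) \<le> real (k choose l) * (real k * v)"
    by (simp only: mult.left_commute)
  moreover have "0 < k choose l" using l_le_k by (simp add: zero_less_binomial)
  ultimately have "real l * ?I \<le> real k * v" by simp
  then show ?thesis using k_pos by (simp add: field_simps)
qed

lemma captured_by_optimal_ge_half:
  assumes "s2 \<in> strategies k"
  shows "1/2 \<le> captured O_k (facilities k s2)"
proof -
  have "captured (facilities k s2) O_k \<le> real k / (2 * real k)"
    using captured_optimal_le_card[of k "facilities k s2"] strategies_facilities[OF assms] k_pos
    by (simp add: facilities_nonempty)
  then show ?thesis using captured_complement[of O_k "facilities k s2"] k_pos by simp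
qed

text \<open>Player 2 deviating to o^k gives the upper bound, \<open>value_ge\<close> with an
  integral of at least 1/2 the lower one. As the two coincide, that integral cannot exceed
  1/2.\<close>

lemma value_eq: "v = real l / (2 * real k)"
  and captured_by_optimal_le_half: "(\<integral>s2. captured O_k (facilities k s2) \<partial>x2) \<le> 1/2"
proof -
  have "v \<le> (\<integral>s1. captured (facilities l s1) O_k \<partial>x1)"
    using optimal_locations_subset by (intro gain_ge_value card_optimal_locations) auto
  also have "\<dots> \<le> (\<integral>s1. real l / (2 * real k) \<partial>x1)"
  proof (rule integral_mono)
    show "integrable x1 (\<lambda>s1. captured (facilities l s1) O_k)"
      using optimal_locations_subset by (intro gain_ge_value card_optimal_locations) auto
    fix s1 assume "s1 \<in> space x1"
    then have "s1 \<in> strategies l" using mixed_strategiesD(3)[OF x1] by simp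
    then show "captured (facilities l s1) O_k \<le> real l / (2 * real k)"
      using captured_optimal_le_card[of k "facilities l s1"] strategies_facilities[of s1 l] k_pos l_pos
      by (simp add: facilities_nonempty)
  qed simp
  finally have up: "v \<le> real l / (2 * real k)" by (simp add: X1.prob_space)
  let ?I = "\<integral>s2. captured O_k (facilities k s2) \<partial>x2"
  have "1/2 = (\<integral>s2. 1/2 \<partial>x2 :: real)" by (simp add: X2.prob_space)
  also have "\<dots> \<le> ?I"
    using integrable_captured_optimal captured_by_optimal_ge_half mixed_strategiesD(3)[OF x2]
    by (intro integral_mono) auto
  finally have half: "1/2 \<le> ?I" .
  have "real l / real k * (1/2) \<le> real l / real k * ?I" using half by (intro mult_left_mono) auto
  then show "v = real l / (2 * real k)" using up value_ge by simp
  have "real l / real k * ?I \<le> real l / real k * (1/2)" using up value_ge by simp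
  moreover have "0 < real l / real k" using l_pos k_pos by simp
  ultimately show "?I \<le> 1/2" by (simp only: mult_le_cancel_left_pos)
qed

text \<open>What o^k captures is at least 1/2 with mean at most 1/2, hence almost surely 1/2; by
  \<open>captured_optimal_less_half\<close> only o^k itself holds o^k to that.\<close>

lemma AE_second_optimal: "AE s2 in x2. facilities k s2 = O_k"
proof -
  have ae: "AE s2 in x2. s2 \<in> strategies k" using mixed_strategiesD(3)[OF x2] AE_space[of x2] by simp
  have "AE s2 in x2. captured O_k (facilities k s2) = 1/2"
  proof (rule X2.AE_eq_of_integral_le[OF integrable_captured_optimal _ captured_by_optimal_le_half])
    show "AE s2 in x2. 1/2 \<le> captured O_k (facilities k s2)"
      using ae by eventually_elim (rule captured_by_optimal_ge_half)
  qed
  with ae show ?thesis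
  proof eventually_elim
    case (elim s2)
    then have "captured (facilities k s2) O_k = 1/2"
      using captured_complement[of O_k "facilities k s2"] by simp
    then show ?case
      using captured_optimal_less_half[of k "facilities k s2"] strategies_facilities[OF elim(1)] k_pos
      by fastforce
  qed
qed

lemma measurable_x1_coordinate: "i \<in> {1..l} \<Longrightarrow> (\<lambda>s. s i) \<in> borel_measurable x1"
  using measurable_coordinate[of i l] mixed_strategiesD(2)[OF x1] by (simp cong: measurable_cong_sets)

lemma measurable_x2_coordinate: "i \<in> {1..k} \<Longrightarrow> (\<lambda>s. s i) \<in> borel_measurable x2"
  using measurable_coordinate[of i k] mixed_strategiesD(2)[OF x2] by (simp cong: measurable_cong_sets)

lemma captured_le_sum_coordinates:
  assumes "s1 \<in> strategies l" "finite B"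
  shows "captured (facilities l s1) B \<le> (\<Sum>i=1..l. captured {s1 i} B)"
  using captured_le_sum[of "facilities l s1" B] assms l_pos
  by (simp add: facilities_nonempty sum_facilities)

lemma coordinate_bounds: "s1 \<in> strategies l \<Longrightarrow> i \<in> {1..l} \<Longrightarrow> 0 \<le> s1 i \<and> s1 i \<le> 1"
  by (auto simp: strategies_def PiE_iff)

section \<open>The facilities of player 1\<close>

text \<open>Against o^k player 1 still earns the full l/(2k), so the losses \<open>h\<close> from
  \<open>captured_optimal_le\<close>, summed over her facilities, have mean at most 0 and vanish
  almost surely.\<close>

lemma AE_first_inside:
  "AE s1 in x1. \<forall>i\<in>{1..l}. optimal_location k 1 \<le> s1 i \<and> s1 i \<le> optimal_location k k"
proof -
  define h where "h f = max 0 (optimal_location k 1 - f) / 2 + max 0 (f - optimal_location k k) / 2" for f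
  have [measurable]: "h \<in> borel_measurable borel" unfolding h_def by measurable
  have h_nonneg: "0 \<le> h f" for f by (simp add: h_def)
  have h_le: "h f \<le> 1" if "0 \<le> f \<and> f \<le> 1" for f
  proof -
    have "optimal_location k 1 \<in> O_k" "optimal_location k k \<in> O_k"
      using k_pos by (auto intro!: optimal_location_mem)
    then have "optimal_location k 1 \<le> 1" "0 \<le> optimal_location k k"
      using optimal_locations_subset[of k] by auto
    then have "max 0 (optimal_location k 1 - f) \<le> 1" "max 0 (f - optimal_location k k) \<le> 1"
      using that by auto
    then show ?thesis unfolding h_def by argo
  qed
  have int_h: "integrable x1 (\<lambda>s1. h (s1 i))" if "i \<in> {1..l}" for i
  proof (rule X1.integrable_const_bound[where B = 1])
    show "AE s1 in x1. norm (h (s1 i)) \<le> 1"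
    proof (rule AE_I2)
      fix s1 assume "s1 \<in> space x1"
      then have "s1 \<in> strategies l" using mixed_strategiesD(3)[OF x1] by simp
      then show "norm (h (s1 i)) \<le> 1"
        using h_le[OF coordinate_bounds[OF _ that]] h_nonneg[of "s1 i"] by simp
    qed
    show "(\<lambda>s1. h (s1 i)) \<in> borel_measurable x1"
      by (rule measurable_compose[OF measurable_x1_coordinate[OF that]]) measurable
  qed
  have int: "integrable x1 (\<lambda>s1. \<Sum>i=1..l. h (s1 i))"
    by (intro Bochner_Integration.integrable_sum int_h)
  have "real l / (2 * real k) \<le> (\<integral>s1. captured (facilities l s1) O_k \<partial>x1)"
    unfolding value_eq[symmetric]
    using optimal_locations_subset by (intro gain_ge_value card_optimal_locations) auto
  also have "\<dots> \<le> (\<integral>s1. real l / (2 * real k) - (\<Sum>i=1..l. h (s1 i)) \<partial>x1)"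
  proof (rule integral_mono)
    show "integrable x1 (\<lambda>s1. captured (facilities l s1) O_k)"
      using optimal_locations_subset by (intro gain_ge_value card_optimal_locations) auto
    show "integrable x1 (\<lambda>s1. real l / (2 * real k) - (\<Sum>i=1..l. h (s1 i)))" using int by simp
    fix s1 assume "s1 \<in> space x1"
    then have s1: "s1 \<in> strategies l" using mixed_strategiesD(3)[OF x1] by simp
    have "captured (facilities l s1) O_k \<le> (\<Sum>i=1..l. captured {s1 i} O_k)"
      using s1 by (intro captured_le_sum_coordinates) auto
    also have "\<dots> \<le> (\<Sum>i=1..l. 1 / (2 * real k) - h (s1 i))"
    proof (rule sum_mono)
      fix i assume "i \<in> {1..l}"
      then show "captured {s1 i} O_k \<le> 1 / (2 * real k) - h (s1 i)"
        using captured_optimal_le[OF k_pos, of "s1 i"] coordinate_bounds[OF s1] unfolding h_def by force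
    qed
    finally show "captured (facilities l s1) O_k \<le> real l / (2 * real k) - (\<Sum>i=1..l. h (s1 i))"
      by (simp add: sum_subtractf)
  qed
  also have "\<dots> = real l / (2 * real k) - (\<integral>s1. (\<Sum>i=1..l. h (s1 i)) \<partial>x1)"
    using int by (simp add: X1.prob_space)
  finally have "(\<integral>s1. (\<Sum>i=1..l. h (s1 i)) \<partial>x1) \<le> 0" by simp
  then have "AE s1 in x1. (\<Sum>i=1..l. h (s1 i)) = 0"
    using int by (intro X1.AE_eq_of_integral_le) (auto intro!: AE_I2 sum_nonneg h_nonneg)
  then show ?thesis
  proof eventually_elim
    case (elim s1)
    then have "\<forall>i\<in>{1..l}. h (s1 i) = 0" by (subst (asm) sum_nonneg_eq_0_iff) (auto simp: h_nonneg)
    moreover have "optimal_location k 1 \<le> f \<and> f \<le> optimal_location k k" if "h f = 0" for f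
      using that max.cobounded1[of 0 "optimal_location k 1 - f"] max.cobounded2[of "optimal_location k 1 - f" 0]
        max.cobounded1[of 0 "f - optimal_location k k"] max.cobounded2[of "f - optimal_location k k" 0]
      unfolding h_def by argo
    ultimately show ?case by blast
  qed
qed

text \<open>Per unit of \<open>\<epsilon>\<close>, \<open>weight n f\<close> bounds what a facility at \<open>f\<close> gains in total over \<open>1 / k\<close>
  against the two shifted deviations of \<open>captured_R_plus_L_le\<close>, with \<open>\<eta> = 1 / (n + 1)\<close> and \<open>\<delta> = 1 / (4 k (n + 1))\<close>.\<close>

definition weight :: "nat \<Rightarrow> real \<Rightarrow> real" where
  "weight n f =
    (if f \<in> O_k then 1 / real (Suc n)
     else if \<forall>i\<in>{1..k}. 1 / (4 * real k * real (Suc n)) < \<bar>f - optimal_location k i\<bar> then - 1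
     else 2 * (real k ^ 2 + 1))"

lemma weight_measurable [measurable]: "weight n \<in> borel_measurable borel"
proof -
  have [measurable]: "O_k \<in> sets borel" by (intro borel_closed finite_imp_closed) simp
  show ?thesis unfolding weight_def by measurable
qed

lemma weight_bounded: "\<bar>weight n f\<bar> \<le> 2 * (real k ^ 2 + 1)"
proof -
  have "1 / real (Suc n) \<le> 1" by simp
  then show ?thesis unfolding weight_def
    by (auto intro: order_trans[of _ 1])
qed

text \<open>A point off o^k keeps a positive distance from the finitely many optimal locations, and
  the threshold eventually drops below it.\<close>

lemma weight_tendsto: "(\<lambda>n. weight n f) \<longlonglongrightarrow> (if f \<in> O_k then 0 else - 1)"
proof (cases "f \<in> O_k")
  case True
  then show ?thesis using LIMSEQ_inverse_real_of_nat by (simp add: weight_def inverse_eq_divide)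
next
  case False
  have "(\<lambda>n. 1 / (4 * real k) * (1 / real (Suc n))) \<longlonglongrightarrow> 1 / (4 * real k) * 0"
    using LIMSEQ_inverse_real_of_nat by (intro tendsto_mult_left) (simp add: inverse_eq_divide)
  then have lim: "(\<lambda>n. 1 / (4 * real k * real (Suc n))) \<longlonglongrightarrow> 0" by simp
  have "\<forall>\<^sub>F n in sequentially. \<forall>i\<in>{1..k}. 1 / (4 * real k * real (Suc n)) < \<bar>f - optimal_location k i\<bar>"
  proof (intro eventually_ball_finite ballI)
    fix i assume "i \<in> {1..k}"
    then have "0 < \<bar>f - optimal_location k i\<bar>" using False by (auto simp: optimal_locations_eq)
    then show "\<forall>\<^sub>F n in sequentially. 1 / (4 * real k * real (Suc n)) < \<bar>f - optimal_location k i\<bar>"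
      by (rule order_tendstoD(2)[OF lim])
  qed simp
  then have "\<forall>\<^sub>F n in sequentially. weight n f = - 1"
    by eventually_elim (use False in \<open>simp add: weight_def\<close>)
  then show ?thesis using False by (simp add: tendsto_eventually)
qed

text \<open>The two deviations together leave player 1 at least 2v = l/k, which is exactly the
  constant part of the upper bound summed over her \<open>l\<close> facilities. Only \<epsilon>
  times the mean weight remains.\<close>

lemma integral_weight_nonneg: "0 \<le> (\<integral>s1. (\<Sum>i=1..l. weight n (s1 i)) \<partial>x1)"
proof -
  \<comment> \<open>Chosen so that \<delta> equals the threshold in \<open>weight\<close>; it is
    within the limit 1/(4k) of \<open>small_shift\<close> for every \<open>n\<close>.\<close>
  define \<epsilon> where "\<epsilon> = 1 / (4 * real k * real (Suc n)) / (real k ^ 2 + 1)"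
  have pos: "0 < real k ^ 2 + 1" by (intro add_nonneg_pos) auto
  have eps: "\<epsilon> * (real k ^ 2 + 1) = 1 / (4 * real k * real (Suc n))" using pos by (simp add: \<epsilon>_def)
  have "0 < \<epsilon>" using pos k_pos by (simp add: \<epsilon>_def)
  interpret small_shift k \<epsilon> "1 / real (Suc n)"
  proof
    show "\<epsilon> * (real k ^ 2 + 1) \<le> 1 / (4 * real k)"
      unfolding eps using k_pos by (intro divide_left_mono) auto
  qed (use k_pos \<open>0 < \<epsilon>\<close> in auto)
  have int_w: "integrable x1 (\<lambda>s1. \<Sum>i=1..l. weight n (s1 i))"
  proof (intro Bochner_Integration.integrable_sum)
    fix i assume "i \<in> {1..l}"
    then show "integrable x1 (\<lambda>s1. weight n (s1 i))"
      using weight_bounded measurable_compose[OF measurable_x1_coordinate weight_measurable]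
      by (intro X1.integrable_const_bound[where B = "2 * (real k ^ 2 + 1)"]) auto
  qed
  have "finite L" by (intro finite_imageI finite_R)
  note dev_R = gain_ge_value[OF R_subset finite_R card_R]
  note dev_L = gain_ge_value[OF L_subset \<open>finite L\<close> card_L]
  have "real l / real k = v + v" unfolding value_eq by simp
  also have "\<dots> \<le> (\<integral>s1. captured (facilities l s1) R + captured (facilities l s1) L \<partial>x1)"
    using dev_R(1) dev_L(1) Bochner_Integration.integral_add[OF dev_R(2) dev_L(2)] by linarith
  also have "\<dots> \<le> (\<integral>s1. real l / real k + \<epsilon> * (\<Sum>i=1..l. weight n (s1 i)) \<partial>x1)"
  proof (rule integral_mono_AE)
    have "AE s1 in x1. s1 \<in> strategies l" using mixed_strategiesD(3)[OF x1] AE_space[of x1] by simp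
    with AE_first_inside show "AE s1 in x1. captured (facilities l s1) R + captured (facilities l s1) L
      \<le> real l / real k + \<epsilon> * (\<Sum>i=1..l. weight n (s1 i))"
    proof eventually_elim
      case (elim s1)
      have "captured (facilities l s1) R + captured (facilities l s1) L
        \<le> (\<Sum>i=1..l. captured {s1 i} R) + (\<Sum>i=1..l. captured {s1 i} L)"
        by (intro add_mono captured_le_sum_coordinates elim(2) finite_R \<open>finite L\<close>)
      also have "\<dots> = (\<Sum>i=1..l. captured {s1 i} R + captured {s1 i} L)" by (simp add: sum.distrib)
      also have "\<dots> \<le> (\<Sum>i=1..l. 1 / real k + \<epsilon> * weight n (s1 i))"
      proof (rule sum_mono)
        fix i assume "i \<in> {1..l}"
        then show "captured {s1 i} R + captured {s1 i} L \<le> 1 / real k + \<epsilon> * weight n (s1 i)"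
          using captured_R_plus_L_le[of "s1 i"] elim(1) unfolding eps weight_def by blast
      qed
      finally show ?case by (simp add: sum.distrib sum_distrib_left)
    qed
  qed (use dev_R(2) dev_L(2) int_w in auto)
  also have "\<dots> = real l / real k + \<epsilon> * (\<integral>s1. (\<Sum>i=1..l. weight n (s1 i)) \<partial>x1)"
    using int_w by (simp add: X1.prob_space)
  finally show ?thesis using \<open>0 < \<epsilon>\<close> by (simp add: zero_le_mult_iff)
qed

text \<open>By dominated convergence the nonnegative mean weights tend to minus the expected number
  of facilities off o^k, so that number is almost surely 0.\<close>

lemma AE_first_optimal: "AE s1 in x1. facilities l s1 \<subseteq> O_k"
proof -
  let ?g = "\<lambda>s1. \<Sum>i=1..l. if s1 i \<in> O_k then 0 else - 1 :: real"
  have [measurable]: "O_k \<in> sets borel" by (intro borel_closed finite_imp_closed) simp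
  have meas: "?g \<in> borel_measurable x1"
  proof (rule borel_measurable_sum)
    fix i assume "i \<in> {1..l}"
    then have [measurable]: "(\<lambda>s. s i) \<in> borel_measurable x1" by (rule measurable_x1_coordinate)
    show "(\<lambda>s1. if s1 i \<in> O_k then 0 else - 1 :: real) \<in> borel_measurable x1" by measurable
  qed
  have "(\<lambda>n. \<integral>s1. (\<Sum>i=1..l. weight n (s1 i)) \<partial>x1) \<longlonglongrightarrow> (\<integral>s1. ?g s1 \<partial>x1)"
  proof (rule integral_dominated_convergence[where w = "\<lambda>_. real l * (2 * (real k ^ 2 + 1))"])
    show "(\<lambda>s1. \<Sum>i=1..l. weight n (s1 i)) \<in> borel_measurable x1" for n
      by (intro borel_measurable_sum measurable_compose[OF measurable_x1_coordinate weight_measurable])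
    show "AE s1 in x1. (\<lambda>n. \<Sum>i=1..l. weight n (s1 i)) \<longlonglongrightarrow> ?g s1"
      by (intro AE_I2 tendsto_sum weight_tendsto)
    show "AE s1 in x1. norm (\<Sum>i=1..l. weight n (s1 i)) \<le> real l * (2 * (real k ^ 2 + 1))" for n
    proof (intro AE_I2)
      fix s1
      have "norm (\<Sum>i=1..l. weight n (s1 i)) \<le> (\<Sum>i=1..l. 2 * (real k ^ 2 + 1))"
        by (rule sum_norm_le) (simp only: real_norm_def weight_bounded)
      then show "norm (\<Sum>i=1..l. weight n (s1 i)) \<le> real l * (2 * (real k ^ 2 + 1))" by simp
    qed
  qed (use meas in auto)
  then have "0 \<le> (\<integral>s1. ?g s1 \<partial>x1)"
    by (rule LIMSEQ_le_const) (use integral_weight_nonneg in blast)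
  moreover have "integrable x1 ?g"
    using meas
  proof (rule X1.integrable_const_bound[where B = "real l", rotated])
    show "AE s1 in x1. norm (?g s1) \<le> real l"
    proof (intro AE_I2)
      fix s1
      have "norm (?g s1) \<le> (\<Sum>i=1..l. 1)" by (rule sum_norm_le) auto
      then show "norm (?g s1) \<le> real l" by simp
    qed
  qed
  ultimately have "AE s1 in x1. - ?g s1 = 0"
    by (intro X1.AE_eq_of_integral_le) (auto intro!: AE_I2 sum_nonpos)
  then show ?thesis
  proof eventually_elim
    case (elim s1)
    then have "(\<Sum>i=1..l. if s1 i \<in> O_k then 0 else 1 :: real) = 0"
      by (simp flip: sum_negf add: if_distrib cong: if_cong)
    then have "\<forall>i\<in>{1..l}. (if s1 i \<in> O_k then 0 else 1 :: real) = 0"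
      by (subst (asm) sum_nonneg_eq_0_iff) auto
    then show ?case by (auto simp: facilities_def split: if_splits)
  qed
qed

lemma AE_all_optimal: "AE (s1, s2) in x1 \<Otimes>\<^sub>M x2. facilities l s1 \<union> facilities k s2 \<subseteq> O_k"
proof (rule P.AE_pair_measure)
  have [measurable]: "O_k \<in> sets borel" by (intro borel_closed finite_imp_closed) simp
  have 1: "Measurable.pred (x1 \<Otimes>\<^sub>M x2) (\<lambda>s. fst s i \<in> O_k)" if "i \<in> {1..l}" for i
  proof -
    have [measurable]: "(\<lambda>s. s i) \<in> borel_measurable x1" using that by (rule measurable_x1_coordinate)
    show ?thesis by measurable
  qed
  have 2: "Measurable.pred (x1 \<Otimes>\<^sub>M x2) (\<lambda>s. snd s i \<in> O_k)" if "i \<in> {1..k}" for i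
  proof -
    have [measurable]: "(\<lambda>s. s i) \<in> borel_measurable x2" using that by (rule measurable_x2_coordinate)
    show ?thesis by measurable
  qed
  \<comment> \<open>\<open>P.AE_pair_measure\<close> asks for a measurable event; the inclusion is a
    finite conjunction of conditions on coordinates.\<close>
  have "Measurable.pred (x1 \<Otimes>\<^sub>M x2)
    (\<lambda>s. (\<forall>i\<in>{1..l}. fst s i \<in> O_k) \<and> (\<forall>i\<in>{1..k}. snd s i \<in> O_k))"
    by (intro pred_intros_logic pred_intros_finite 1 2) auto
  moreover have "(\<lambda>s. (\<forall>i\<in>{1..l}. fst s i \<in> O_k) \<and> (\<forall>i\<in>{1..k}. snd s i \<in> O_k))
    = (\<lambda>(s1, s2). facilities l s1 \<union> facilities k s2 \<subseteq> O_k)"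
    by (auto simp: facilities_def fun_eq_iff)
  ultimately have "Measurable.pred (x1 \<Otimes>\<^sub>M x2) (\<lambda>(s1, s2). facilities l s1 \<union> facilities k s2 \<subseteq> O_k)"
    by (simp only:)
  then show "{s \<in> space (x1 \<Otimes>\<^sub>M x2). case s of (s1, s2) \<Rightarrow> facilities l s1 \<union> facilities k s2 \<subseteq> O_k}
    \<in> sets (x1 \<Otimes>\<^sub>M x2)"
    by (simp only: pred_def)
  show "AE s1 in x1. AE s2 in x2. case (s1, s2) of (s1, s2) \<Rightarrow> facilities l s1 \<union> facilities k s2 \<subseteq> O_k"
    using AE_first_optimal
  proof eventually_elim
    case (elim s1)
    show ?case using AE_second_optimal by eventually_elim (use elim in auto)
  qed
qed

end

theorem corollary3:
  fixes l k :: nat and x1 x2 :: "(nat \<Rightarrow> real) measure"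
  assumes "1 \<le> l" and "l \<le> k"
    and "x1 \<in> mixed_strategies l" and "x2 \<in> mixed_strategies k"
    and "nash_equilibrium l k x1 x2"
  shows "AE (s1, s2) in x1 \<Otimes>\<^sub>M x2. facilities l s1 \<union> facilities k s2 \<subseteq> optimal_locations k"
proof -
  interpret equilibrium l k x1 x2
    using assms by unfold_locales auto
  show ?thesis by (rule AE_all_optimal)
qed

end
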